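(* Let $\lambda,\gamma\in\mathbb{C}$. The Gegenbauer generating function $$\sum_{n=0}^\infty {}_2F_1\!\left({{-n,\,2\lambda-\gamma}\atop{2\lambda}}\Bigm| u\right) C_n^\lambda(x)\,t^n$$ is algebraic, for arbitrary $u$, (1) if $\lambda\in\mathbb{Z}\pm\frac14$ with $\gamma-\lambda\in\mathbb{Z}\pm\frac13$; or (2) if $\lambda\in\mathbb{Z}\pm\frac16$ with $\gamma-\lambda\in\mathbb{Z}\pm\{\frac13,\frac14\}$.
   Context: For $\lambda\in\mathbb{C}$ the Gegenbauer polynomials $C_n^\lambda(x)$, $n=0,1,2,\dots$, are defined by $\sum_{n=0}^\infty C_n^\lambda(x)t^n=(1-2xt+t^2)^{-\lambda}$ (as a power series in $t$ with constant term $1$). ${}_2F_1$ is the Gauss hypergeometric function; the series ${}_2F_1(-n,b;c\,|\,u)$ terminates and is a polynomial in $u$. The notation $\mathbb{Z}\pm a$ means the set of all numbers differing from an integer by $a$ or $-a$, and $\mathbb{Z}\pm\{a,b\}=(\mathbb{Z}\pm a)\cup(\mathbb{Z}\pm b)$; all sign choices are independent. "Algebraic" means that the power series in $t$ defines an algebraic function of its arguments, the algebraicity being in $u$ as well as in $t,x$. *)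

theory Defs
  imports Complex_Main "HOL-Computational_Algebra.Computational_Algebra"
begin

text \<open>
  The Gegenbauer polynomials, by their generating function: the power series expansion of
  \<open>(1 - 2 x t + t\<^sup>2) powr (-lam)\<close> with constant term \<open>1\<close>, where \<open>t\<close> is the variable of the power
  series and \<open>x\<close> the polynomial variable of the coefficient ring. The library's \<^const>\<open>fps_binomial\<close>
  is only available over fields, so its coefficients are embedded into the polynomial ring first.
\<close>

definition gegenbauer_gf :: "complex \<Rightarrow> complex poly fps" where
  "gegenbauer_gf lam =
     fps_compose (Abs_fps (\<lambda>k. [:fps_nth (fps_binomial (-lam)) k:]))
                 (fps_X ^ 2 - fps_const [:0, 2:] * fps_X)"

definition gegenbauer :: "complex \<Rightarrow> nat \<Rightarrow> complex poly" where
  "gegenbauer lam n = fps_nth (gegenbauer_gf lam) n"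

lemma poly_gegenbauer:
  "poly (gegenbauer lam n) x =
     fps_nth (fps_compose (fps_binomial (-lam)) (fps_X ^ 2 - fps_const (2 * x) * fps_X)) n"
proof -
  define E :: "complex poly fps \<Rightarrow> complex fps"
    where "E F = Abs_fps (\<lambda>n. poly (fps_nth F n) x)" for F
  have E_mult: "E (F * G) = E F * E G" for F G
    by (rule fps_ext) (simp add: E_def fps_mult_nth poly_sum)
  have E_1: "E 1 = 1"
    by (rule fps_ext) (simp add: E_def)
  have E_power: "E (F ^ i) = E F ^ i" for F i
    by (induction i) (simp_all add: E_1 E_mult)
  have E_X: "E fps_X = fps_X"
    by (rule fps_ext) (simp add: E_def fps_X_def)
  have E_const: "E (fps_const c) = fps_const (poly c x)" for c
    by (rule fps_ext) (simp add: E_def)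
  have E_diff: "E (F - G) = E F - E G" for F G
    by (rule fps_ext) (simp add: E_def)
  have arg: "E (fps_X ^ 2 - fps_const [:0, 2:] * fps_X) = fps_X ^ 2 - fps_const (2 * x) * fps_X"
    by (simp add: E_diff E_power E_mult E_X E_const mult.commute)
  have E_nth: "poly (fps_nth F k) x = fps_nth (E F) k" for F k
    by (simp add: E_def)
  show ?thesis
    by (simp add: gegenbauer_def gegenbauer_gf_def fps_compose_nth poly_sum E_nth E_power arg
             del: fps_binomial_nth)
qed

text \<open>
  The Gauss hypergeometric series with first upper parameter \<open>-n\<close> terminates, so cutting it off
  after the term of degree \<open>n\<close> turns it into a polynomial without changing it.
\<close>

definition gauss_2F1_poly :: "nat \<Rightarrow> complex \<Rightarrow> complex \<Rightarrow> complex poly" where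
  "gauss_2F1_poly n b c = truncate_fps (Suc n) (fps_hypergeo [- of_nat n, b] [c] 1)"

lemma fps_of_poly_gauss_2F1_poly:
  "fps_of_poly (gauss_2F1_poly n b c) = fps_hypergeo [- of_nat n, b] [c] 1"
  by (rule fps_ext)
     (auto simp: gauss_2F1_poly_def coeff_truncate_fps pochhammer_of_nat_eq_0_iff)

text \<open>
  Formal power series in \<open>t\<close> over \<open>\<complex>[u][x]\<close>: in type \<^typ>\<open>complex poly poly\<close> the inner polynomial
  variable is \<open>u\<close> and the outer one is \<open>x\<close>.
\<close>

definition gegenbauer_2F1_gf :: "complex \<Rightarrow> complex \<Rightarrow> complex poly poly fps" where
  "gegenbauer_2F1_gf lam \<gamma> =
     Abs_fps (\<lambda>n. smult (gauss_2F1_poly n (2 * lam - \<gamma>) (2 * lam))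
                        (map_poly (\<lambda>a. [:a:]) (gegenbauer lam n)))"

text \<open>
  A formal power series \<open>F\<close> in \<open>t\<close> over a domain \<open>R\<close> is algebraic if \<open>P(t, F) = 0\<close> for some nonzero
  \<open>P \<in> R[t][Y]\<close>; such a \<open>P\<close> automatically has positive degree in \<open>Y\<close>. For \<open>R = \<complex>[u][x]\<close> this is joint
  algebraicity in \<open>u\<close>, \<open>x\<close> and \<open>t\<close>.
\<close>

definition algebraic_fps :: "'a :: idom fps \<Rightarrow> bool" where
  "algebraic_fps F \<longleftrightarrow> (\<exists>P :: 'a poly poly. P \<noteq> 0 \<and> poly (map_poly fps_of_poly P) F = 0)"

definition int_pm :: "complex \<Rightarrow> complex set" where
  "int_pm a = {z. \<exists>k\<in>\<int>. z = k + a \<or> z = k - a}"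

end

theory Submission
  imports Defs
begin

text \<open>
  Write \<open>b = 2 lam - \<gamma>\<close>, \<open>R = 1 - 2 x t + t\<^sup>2\<close> and \<open>W = R + u t (x - t)\<close>. The generating function has
  the closed form
  \<open>R powr (b - lam) * W powr (- b) * F ((x\<^sup>2 - 1) u\<^sup>2 t\<^sup>2 / W\<^sup>2)\<close>
  with the Gauss series \<open>F = 2F1 (b/2, (b + 1)/2; lam + 1/2)\<close>. Indeed the weight \<open>(n choose j)\<close> in the
  terminating \<open>2F1\<close> turns \<open>R powr (- lam)\<close> into its Taylor coefficients, which are explicit
  polynomials in \<open>(x - t)/R\<close> and \<open>(x\<^sup>2 - 1)/R\<^sup>2\<close> (lemma \<open>gegenbauer_taylor\<close>); summing them up gives
  the formula (theorem \<open>gegenbauer_2F1_closed_form\<close>, which keeps \<open>W / R = 1 - A\<close> as one unit).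
  For rational parameters all powers are algebraic, so only the algebraicity of \<open>F\<close> is left.

  The exponent differences of the equation of \<open>F\<close> at \<open>0\<close>, \<open>1\<close> and infinity are \<open>1/2 - lam\<close>,
  \<open>\<gamma> - lam\<close> and \<open>1/2\<close>. The hypotheses make them, modulo the integers and up to sign, equal to
  \<open>(1/4, 1/3, 1/2)\<close>, \<open>(1/3, 1/3, 1/2)\<close> or \<open>(1/3, 1/4, 1/2)\<close>: these are the tetrahedral and
  octahedral equations of Schwarz's list, whose monodromy groups are finite.
  For one representative of each class an explicit rational covering \<open>r\<close> is given on which the series
  becomes a product of powers of polynomials (lemma \<open>darboux_evaluation\<close>), which is verified by
  substitution into the differential equation. As \<open>r\<close> has an algebraic compositional inverse, the series
  is algebraic. Gauss's contiguity relations carry this to all integer shifts of the parameters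
  (theorem \<open>algebraic_gauss_contiguous\<close>), and Euler's transformation (theorem \<open>gauss_fps_euler\<close>)
  changes the sign of \<open>\<gamma> - lam\<close>. The sign of \<open>lam\<close> modulo the integers is treated by a second evaluation
  on the same covering.

  All of this rests on closure properties of algebraic series: they form a ring, a root of a nonzero
  polynomial with algebraic coefficients is algebraic (theorem \<open>algebraic_over_root\<close>), and derivatives
  and compositions of algebraic series are algebraic.
\<close>

section \<open>Algebraic elements over a subring of a domain\<close>

locale idom_subring =
  fixes K :: "'v :: idom set"
  assumes zero_K [simp, intro]: "0 \<in> K" and one_K [simp, intro]: "1 \<in> K"
    and diff_K: "a \<in> K \<Longrightarrow> b \<in> K \<Longrightarrow> a - b \<in> K"
    and mult_K [intro]: "a \<in> K \<Longrightarrow> b \<in> K \<Longrightarrow> a * b \<in> K"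
begin

lemma uminus_K [intro]: "a \<in> K \<Longrightarrow> - a \<in> K"
  using diff_K [of 0 a] by simp

lemma add_K [intro]: "a \<in> K \<Longrightarrow> b \<in> K \<Longrightarrow> a + b \<in> K"
  using diff_K [of a "- b"] by auto

lemma sum_K: "(\<And>i. i \<in> I \<Longrightarrow> f i \<in> K) \<Longrightarrow> sum f I \<in> K"
  by (induction I rule: infinite_finite_induct) auto

text \<open>
  The subring need not be a field, so Gaussian elimination is done by cross-multiplication, one
  equation at a time.
\<close>

lemma homogeneous_system_nontrivial_solution:
  assumes "finite I" "finite J" "card I < card J"
    and "\<And>i j. i \<in> I \<Longrightarrow> j \<in> J \<Longrightarrow> A i j \<in> K"
  shows "\<exists>x. (\<forall>j\<in>J. x j \<in> K) \<and> (\<exists>j\<in>J. x j \<noteq> 0) \<and> (\<forall>i\<in>I. (\<Sum>j\<in>J. A i j * x j) = 0)"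
  using assms
proof (induction I arbitrary: J A rule: finite_induct)
  case empty
  then have "J \<noteq> {}" by auto
  then show ?case by (intro exI [of _ "\<lambda>_. 1"]) auto
next
  case (insert m I)
  show ?case
  proof (cases "\<forall>j\<in>J. A m j = 0")
    case True
    have "\<exists>x. (\<forall>j\<in>J. x j \<in> K) \<and> (\<exists>j\<in>J. x j \<noteq> 0) \<and> (\<forall>i\<in>I. (\<Sum>j\<in>J. A i j * x j) = 0)"
      using insert by (intro insert.IH) auto
    with True show ?thesis by auto
  next
    case False
    then obtain p where p: "p \<in> J" "A m p \<noteq> 0" by auto
    define J' where "J' = J - {p}"
    have J': "finite J'" "card I < card J'" "J = insert p J'" "p \<notin> J'"
      using insert p by (auto simp: J'_def)
    have AK: "A i j \<in> K" if "i \<in> insert m I" "j \<in> J" for i j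
      using that insert.prems by blast
    \<comment> \<open>Fraction-free elimination of the unknown \<open>x p\<close> with the equation \<open>m\<close>.\<close>
    define A' where "A' i j = A m p * A i j - A i p * A m j" for i j
    have "\<exists>x. (\<forall>j\<in>J'. x j \<in> K) \<and> (\<exists>j\<in>J'. x j \<noteq> 0) \<and> (\<forall>i\<in>I. (\<Sum>j\<in>J'. A' i j * x j) = 0)"
      using J' AK by (intro insert.IH) (auto simp: A'_def intro!: diff_K mult_K)
    then obtain x where x: "\<forall>j\<in>J'. x j \<in> K" "\<exists>j\<in>J'. x j \<noteq> 0"
      and sol: "\<And>i. i \<in> I \<Longrightarrow> (\<Sum>j\<in>J'. A' i j * x j) = 0" by blast
    define y where "y j = (if j = p then - (\<Sum>j\<in>J'. A m j * x j) else A m p * x j)" for j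
    have y_J': "y j = A m p * x j" if "j \<in> J'" for j
      using that J' by (auto simp: y_def)
    have sum_y: "(\<Sum>j\<in>J. A i j * y j)
        = - (A i p * (\<Sum>j\<in>J'. A m j * x j)) + A m p * (\<Sum>j\<in>J'. A i j * x j)" for i
    proof -
      have "(\<Sum>j\<in>J. A i j * y j) = A i p * y p + (\<Sum>j\<in>J'. A i j * y j)"
        using J' by simp
      also have "(\<Sum>j\<in>J'. A i j * y j) = A m p * (\<Sum>j\<in>J'. A i j * x j)"
        unfolding sum_distrib_left by (intro sum.cong) (simp_all add: y_J' ac_simps)
      finally show ?thesis by (simp add: y_def)
    qed
    have "(\<Sum>j\<in>J. A i j * y j) = 0" if "i \<in> I" for i
    proof -
      have "(\<Sum>j\<in>J'. A' i j * x j)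
          = A m p * (\<Sum>j\<in>J'. A i j * x j) - A i p * (\<Sum>j\<in>J'. A m j * x j)"
        unfolding sum_distrib_left sum_subtractf [symmetric]
        by (intro sum.cong) (simp_all add: A'_def algebra_simps)
      with sol [OF that] show ?thesis by (simp add: sum_y)
    qed
    moreover have "(\<Sum>j\<in>J. A m j * y j) = 0" by (simp add: sum_y)
    moreover have "y j \<in> K" if "j \<in> J" for j
      using that x AK J' by (auto simp: y_def intro!: sum_K uminus_K mult_K)
    moreover have "\<exists>j\<in>J. y j \<noteq> 0"
      using x(2) p J'(3) by (auto simp: y_J')
    ultimately show ?thesis by (intro exI [of _ y]) auto
  qed
qed

definition algebraic_over :: "'v \<Rightarrow> bool" where
  "algebraic_over v \<longleftrightarrow> (\<exists>P. P \<noteq> 0 \<and> (\<forall>i. coeff P i \<in> K) \<and> poly P v = 0)"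

text \<open>
  The span of \<open>B\<close> over the fraction field of \<open>K\<close>, intersected with the ambient domain: the
  denominator \<open>d\<close> is kept on the other side because the ambient domain need not contain the
  fraction field.
\<close>

definition frac_span :: "'v set \<Rightarrow> 'v set" where
  "frac_span B = {v. \<exists>d\<in>K - {0}. \<exists>c. (\<forall>b\<in>B. c b \<in> K) \<and> d * v = (\<Sum>b\<in>B. c b * b)}"

lemma frac_spanI:
  "d \<in> K \<Longrightarrow> d \<noteq> 0 \<Longrightarrow> (\<And>b. b \<in> B \<Longrightarrow> c b \<in> K) \<Longrightarrow> d * v = (\<Sum>b\<in>B. c b * b) \<Longrightarrow> v \<in> frac_span B"
  unfolding frac_span_def by blast

lemma frac_spanE:
  assumes "v \<in> frac_span B"
  obtains d c where "d \<in> K" "d \<noteq> 0" "\<And>b. b \<in> B \<Longrightarrow> c b \<in> K" "d * v = (\<Sum>b\<in>B. c b * b)"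
  using assms unfolding frac_span_def by blast

lemma frac_span_zero: "0 \<in> frac_span B"
  by (rule frac_spanI [of 1 _ "\<lambda>_. 0"]) auto

lemma frac_span_base: "finite B \<Longrightarrow> b \<in> B \<Longrightarrow> b \<in> frac_span B"
  by (rule frac_spanI [of 1 _ "\<lambda>x. if x = b then 1 else 0"]) (auto simp: if_distrib [of "\<lambda>c. c * _"] cong: if_cong)

lemma frac_span_add:
  assumes "v \<in> frac_span B" "w \<in> frac_span B"
  shows "v + w \<in> frac_span B"
proof -
  from assms obtain d c e c' where
    d: "d \<in> K" "d \<noteq> 0" "\<And>b. b \<in> B \<Longrightarrow> c b \<in> K" "d * v = (\<Sum>b\<in>B. c b * b)" and
    e: "e \<in> K" "e \<noteq> 0" "\<And>b. b \<in> B \<Longrightarrow> c' b \<in> K" "e * w = (\<Sum>b\<in>B. c' b * b)"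
    by (elim frac_spanE) blast
  have "(d * e) * (v + w) = e * (d * v) + d * (e * w)" by (simp add: algebra_simps)
  also have "\<dots> = (\<Sum>b\<in>B. (e * c b + d * c' b) * b)"
    by (simp add: d e sum_distrib_left sum.distrib [symmetric] algebra_simps)
  finally show ?thesis using d e by (intro frac_spanI [of "d * e"]) auto
qed

lemma frac_span_scale:
  assumes "v \<in> frac_span B" "a \<in> K"
  shows "a * v \<in> frac_span B"
proof -
  from assms obtain d c where
    d: "d \<in> K" "d \<noteq> 0" "\<And>b. b \<in> B \<Longrightarrow> c b \<in> K" "d * v = (\<Sum>b\<in>B. c b * b)"
    by (elim frac_spanE) blast
  have "d * (a * v) = a * (d * v)" by simp
  also have "\<dots> = (\<Sum>b\<in>B. (a * c b) * b)"
    by (simp add: d sum_distrib_left algebra_simps)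
  finally show ?thesis using d assms by (intro frac_spanI [of d]) auto
qed

lemma frac_span_unscale:
  assumes "a * v \<in> frac_span B" "a \<in> K" "a \<noteq> 0"
  shows "v \<in> frac_span B"
proof -
  from assms obtain d c where
    d: "d \<in> K" "d \<noteq> 0" "\<And>b. b \<in> B \<Longrightarrow> c b \<in> K" "d * (a * v) = (\<Sum>b\<in>B. c b * b)"
    by (elim frac_spanE) blast
  then show ?thesis using assms by (intro frac_spanI [of "d * a" _ c]) (auto simp: mult.assoc)
qed

lemma frac_span_sum: "(\<And>i. i \<in> I \<Longrightarrow> f i \<in> frac_span B) \<Longrightarrow> sum f I \<in> frac_span B"
  by (induction I rule: infinite_finite_induct) (auto intro: frac_span_add frac_span_zero)

lemma frac_span_mult_induct:
  assumes "v \<in> frac_span B" "\<And>b. b \<in> B \<Longrightarrow> y * b \<in> frac_span C"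
  shows "y * v \<in> frac_span C"
proof -
  from assms(1) obtain d c where
    d: "d \<in> K" "d \<noteq> 0" "\<And>b. b \<in> B \<Longrightarrow> c b \<in> K" "d * v = (\<Sum>b\<in>B. c b * b)"
    by (elim frac_spanE) blast
  have "d * (y * v) = y * (d * v)" by simp
  also have "\<dots> = (\<Sum>b\<in>B. c b * (y * b))"
    by (simp add: d sum_distrib_left algebra_simps)
  also have "\<dots> \<in> frac_span C"
    by (intro frac_span_sum frac_span_scale assms d)
  finally show ?thesis by (rule frac_span_unscale) (use d in auto)
qed

text \<open>
  The powers \<open>y ^ 0, \<dots>, y ^ card B\<close> all lie in the span of the \<open>card B\<close> elements of \<open>B\<close>,
  so they are linearly dependent, and the dependency is a polynomial equation for \<open>y\<close>.
\<close>

lemma algebraic_over_if_stable: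
  assumes B: "finite B" "1 \<in> frac_span B" and y: "\<And>b. b \<in> B \<Longrightarrow> y * b \<in> frac_span B"
  shows "algebraic_over y"
proof -
  have "y ^ k \<in> frac_span B" for k
    by (induction k) (auto intro: B frac_span_mult_induct y)
  then have "\<forall>k. \<exists>d c. d \<in> K \<and> d \<noteq> 0 \<and> (\<forall>b\<in>B. c b \<in> K) \<and> d * y ^ k = (\<Sum>b\<in>B. c b * b)"
    unfolding frac_span_def by blast
  then obtain d c where d: "\<And>k. d k \<in> K" "\<And>k. d k \<noteq> 0" "\<And>k b. b \<in> B \<Longrightarrow> c k b \<in> K"
    and eq: "\<And>k. d k * y ^ k = (\<Sum>b\<in>B. c k b * b)" by metis
  have "\<exists>x. (\<forall>k\<in>{..card B}. x k \<in> K) \<and> (\<exists>k\<in>{..card B}. x k \<noteq> 0)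
      \<and> (\<forall>b\<in>B. (\<Sum>k\<in>{..card B}. c k b * x k) = 0)"
    by (rule homogeneous_system_nontrivial_solution) (use B d in auto)
  then obtain x where x: "\<forall>k\<in>{..card B}. x k \<in> K" "\<exists>k\<in>{..card B}. x k \<noteq> 0"
    and sol: "\<And>b. b \<in> B \<Longrightarrow> (\<Sum>k\<le>card B. c k b * x k) = 0" by blast
  define P where "P = (\<Sum>k\<le>card B. monom (x k * d k) k)"
  have coeff_P: "coeff P i = (if i \<le> card B then x i * d i else 0)" for i
    by (simp add: P_def coeff_sum)
  have "poly P y = (\<Sum>k\<le>card B. x k * (d k * y ^ k))"
    by (simp add: P_def poly_sum poly_monom mult.assoc)
  also have "\<dots> = (\<Sum>k\<le>card B. \<Sum>b\<in>B. b * (c k b * x k))"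
    by (simp add: eq sum_distrib_left ac_simps)
  also have "\<dots> = (\<Sum>b\<in>B. b * (\<Sum>k\<le>card B. c k b * x k))"
    by (subst sum.swap) (simp add: sum_distrib_left)
  also have "\<dots> = 0" by (simp add: sol)
  finally have "poly P y = 0" .
  moreover have "P \<noteq> 0"
    using x(2) d(2) coeff_P by (metis atMost_iff coeff_0 mult_eq_0_iff)
  moreover have "coeff P i \<in> K" for i
    using x d by (auto simp: coeff_P)
  ultimately show ?thesis unfolding algebraic_over_def by blast
qed

text \<open>
  A finite set whose span is a ring, that is, a finite-dimensional algebra over the fraction
  field. All elements of such a span are algebraic, and every finite family of algebraic elements
  lies in one; hence all closure properties of algebraic elements reduce to the ring structure of
  a single span.
\<close>

definition finite_algebra :: "'v set \<Rightarrow> bool" where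
  "finite_algebra B \<longleftrightarrow> finite B \<and> 1 \<in> frac_span B \<and> (\<forall>b\<in>B. \<forall>b'\<in>B. b * b' \<in> frac_span B)"

lemma finite_algebra_mult:
  assumes "finite_algebra B" "v \<in> frac_span B" "w \<in> frac_span B"
  shows "v * w \<in> frac_span B"
proof (rule frac_span_mult_induct [OF assms(3)])
  fix b assume b: "b \<in> B"
  have "b * v \<in> frac_span B"
    using assms(1) b by (intro frac_span_mult_induct [OF assms(2)]) (auto simp: finite_algebra_def)
  then show "v * b \<in> frac_span B" by (simp add: mult.commute)
qed

lemma finite_algebra_algebraic:
  assumes "finite_algebra B" "v \<in> frac_span B"
  shows "algebraic_over v"
  using assms finite_algebra_mult [OF assms]
  by (intro algebraic_over_if_stable [of B]) (auto simp: finite_algebra_def frac_span_base)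

lemma finite_algebra_K:
  assumes "finite_algebra B" "a \<in> K"
  shows "a \<in> frac_span B"
  using frac_span_scale [of 1 B a] assms by (simp add: finite_algebra_def)

lemma finite_algebra_poly:
  assumes "finite_algebra B" "\<And>i. coeff P i \<in> frac_span B" "v \<in> frac_span B"
  shows "poly P v \<in> frac_span B"
proof -
  have "v ^ i \<in> frac_span B" for i
    using assms(1) by (induction i)
      (auto simp: finite_algebra_def intro: finite_algebra_mult [OF assms(1)] assms(3))
  then show ?thesis
    unfolding poly_altdef by (intro frac_span_sum finite_algebra_mult assms)
qed

lemma finite_algebra_one: "finite_algebra {1}"
  by (auto simp: finite_algebra_def intro: frac_span_base)

text \<open>
  In a polynomial equation of least degree for a nonzero element \<open>q\<close> of a domain the constant
  term \<open>d\<close> is nonzero, since otherwise \<open>q\<close> could be cancelled; solving for \<open>d\<close> exhibits it as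
  a multiple of \<open>q\<close>.
\<close>

lemma finite_algebra_pseudo_inverse:
  assumes B: "finite_algebra B" and q: "q \<in> frac_span B" "q \<noteq> 0"
  shows "\<exists>s\<in>frac_span B. \<exists>d\<in>K - {0}. s * q = d"
proof -
  have "\<exists>P. P \<noteq> 0 \<and> (\<forall>i. coeff P i \<in> K) \<and> poly P q = 0"
    using finite_algebra_algebraic [OF B q(1)] by (simp add: algebraic_over_def)
  from ex_has_least_nat [of "\<lambda>P. P \<noteq> 0 \<and> (\<forall>i. coeff P i \<in> K) \<and> poly P q = 0" _ degree] this
  obtain P where P: "P \<noteq> 0" "\<And>i. coeff P i \<in> K" "poly P q = 0"
    and min: "\<And>R. R \<noteq> 0 \<Longrightarrow> (\<And>i. coeff R i \<in> K) \<Longrightarrow> poly R q = 0 \<Longrightarrow> degree P \<le> degree R"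
    by metis
  obtain p P' where P_eq: "P = pCons p P'" by (cases P)
  have P'K: "coeff P' i \<in> K" for i using P(2) [of "Suc i"] by (simp add: P_eq)
  have p: "p \<in> K" using P(2) [of 0] by (simp add: P_eq)
  have root: "p + q * poly P' q = 0" using P(3) by (simp add: P_eq)
  have "p \<noteq> 0"
  proof
    assume "p = 0"
    with root q have "poly P' q = 0" by simp
    moreover have "P' \<noteq> 0" using P(1) \<open>p = 0\<close> by (auto simp: P_eq)
    ultimately show False using min [of P'] P'K by (simp add: P_eq)
  qed
  moreover have "- poly P' q \<in> frac_span B"
    using frac_span_scale [OF finite_algebra_poly [OF B, of P' q], of "- 1"] q P'K
    by (simp add: finite_algebra_K [OF B] uminus_K)
  moreover have "- poly P' q * q = p"
    using root by (simp add: add_eq_0_iff mult.commute)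
  ultimately show ?thesis using p by blast
qed

text \<open>
  After multiplication by a pseudo-inverse of the leading coefficient, the equation of degree \<open>n\<close>
  rewrites \<open>v ^ n\<close> in terms of lower powers, so the products \<open>b * v ^ i\<close> with \<open>b \<in> B\<close> and
  \<open>i < n\<close> span a ring.
\<close>

lemma finite_algebra_adjoin_root:
  assumes B: "finite_algebra B" and Q: "Q \<noteq> 0" "\<And>i. coeff Q i \<in> frac_span B" "poly Q v = 0"
  shows "\<exists>B'. finite_algebra B' \<and> frac_span B \<subseteq> frac_span B' \<and> v \<in> frac_span B'"
proof -
  define n where "n = degree Q"
  obtain s d where s: "s \<in> frac_span B" and d: "d \<in> K" "d \<noteq> 0" "s * lead_coeff Q = d"
    using finite_algebra_pseudo_inverse [OF B Q(2)] Q(1) by (metis DiffD1 DiffD2 insertI1 leading_coeff_0_iff)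
  have n: "n > 0"
  proof (rule ccontr)
    assume "\<not> n > 0"
    then obtain a where "Q = [:a:]" by (auto simp: n_def elim: degree_eq_zeroE)
    with Q(1,3) show False by auto
  qed
  define c where "c i = - (s * coeff Q i)" for i
  have c: "c i \<in> frac_span B" for i
    using frac_span_scale [OF finite_algebra_mult [OF B s Q(2)], of "- 1" i]
    by (simp add: c_def uminus_K)
  have red: "d * v ^ n = (\<Sum>i<n. c i * v ^ i)"
  proof -
    have "0 = s * poly Q v" using Q by simp
    also have "\<dots> = s * lead_coeff Q * v ^ n + (\<Sum>i<n. s * coeff Q i * v ^ i)"
      by (simp add: poly_altdef n_def [symmetric] lessThan_Suc_atMost [symmetric] sum_distrib_left algebra_simps)
    finally show ?thesis
      by (simp add: d c_def sum_negf add_eq_0_iff)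
  qed
  define B' where "B' = (\<lambda>(b, i). b * v ^ i) ` (B \<times> {..<n})"
  have fin: "finite B'" using B by (simp add: B'_def finite_algebra_def)
  have mon: "x * v ^ i \<in> frac_span B'" if "x \<in> frac_span B" for x i
    using that
  proof (induction i arbitrary: x rule: less_induct)
    case (less i)
    show ?case
    proof (cases "i < n")
      case True
      have "v ^ i * x \<in> frac_span B'"
        by (rule frac_span_mult_induct [OF less.prems], rule frac_span_base [OF fin])
          (use True in \<open>auto simp: B'_def mult.commute\<close>)
      then show ?thesis by (simp add: mult.commute)
    next
      case False
      have "d * (x * v ^ i) = (d * v ^ n) * (x * v ^ (i - n))"
        using False by (simp add: power_add [symmetric])
      also have "\<dots> = (\<Sum>j<n. (c j * x) * v ^ (j + (i - n)))"
        by (simp add: red sum_distrib_right sum_distrib_left power_add ac_simps)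
      also have "\<dots> \<in> frac_span B'"
        using False by (intro frac_span_sum less.IH finite_algebra_mult [OF B] c less.prems) auto
      finally show ?thesis by (rule frac_span_unscale) (use d in auto)
    qed
  qed
  have 1: "1 \<in> frac_span B" using B by (simp add: finite_algebra_def)
  have "finite_algebra B'"
    unfolding finite_algebra_def
  proof (intro conjI ballI)
    show "1 \<in> frac_span B'" using mon [OF 1, of 0] by simp
    fix x y assume "x \<in> B'" "y \<in> B'"
    then obtain b i b' j where "b \<in> B" "b' \<in> B" and xy: "x = b * v ^ i" "y = b' * v ^ j"
      by (auto simp: B'_def)
    then have "b * b' \<in> frac_span B" using B by (auto simp: finite_algebra_def)
    from mon [OF this, of "i + j"] show "x * y \<in> frac_span B'"
      by (simp add: xy power_add ac_simps)
  qed (rule fin)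
  moreover have "frac_span B \<subseteq> frac_span B'" using mon [of _ 0] by auto
  moreover have "v \<in> frac_span B'" using mon [OF 1, of 1] by simp
  ultimately show ?thesis by blast
qed

lemma common_finite_algebra:
  assumes "finite V" "\<And>v. v \<in> V \<Longrightarrow> algebraic_over v"
  shows "\<exists>B. finite_algebra B \<and> V \<subseteq> frac_span B"
  using assms
proof (induction V rule: finite_induct)
  case empty
  show ?case using finite_algebra_one by blast
next
  case (insert v V)
  then obtain B where B: "finite_algebra B" "V \<subseteq> frac_span B" by auto
  from insert.prems obtain Q where "Q \<noteq> 0" "\<forall>i. coeff Q i \<in> K" "poly Q v = 0"
    by (auto simp: algebraic_over_def)
  with finite_algebra_adjoin_root [OF B(1), of Q v] finite_algebra_K [OF B(1)] B(2)
  show ?case by blast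
qed

theorem algebraic_over_root:
  assumes "Q \<noteq> 0" "\<And>i. algebraic_over (coeff Q i)" "poly Q v = 0"
  shows "algebraic_over v"
proof -
  have "finite (coeff Q ` {..degree Q})" by simp
  then obtain B where B: "finite_algebra B" "coeff Q ` {..degree Q} \<subseteq> frac_span B"
    using common_finite_algebra [of "coeff Q ` {..degree Q}"] assms(2) by auto
  have "coeff Q i \<in> frac_span B" for i
    using B(2) by (cases "i \<le> degree Q") (auto simp: coeff_eq_0 frac_span_zero)
  with finite_algebra_adjoin_root [OF B(1) assms(1) _ assms(3)] finite_algebra_algebraic
  show ?thesis by blast
qed

lemma algebraic_over_K: "a \<in> K \<Longrightarrow> algebraic_over a"
  using finite_algebra_algebraic finite_algebra_K finite_algebra_one by blast

lemma algebraic_over_add: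
  assumes "algebraic_over v" "algebraic_over w"
  shows "algebraic_over (v + w)"
  using common_finite_algebra [of "{v, w}"] assms
  by (auto intro: finite_algebra_algebraic frac_span_add)

lemma algebraic_over_mult:
  assumes "algebraic_over v" "algebraic_over w"
  shows "algebraic_over (v * w)"
  using common_finite_algebra [of "{v, w}"] assms
  by (auto intro: finite_algebra_algebraic finite_algebra_mult)

end

section \<open>Algebraic power series\<close>

interpretation poly_fps: idom_subring "range fps_of_poly :: 'a :: idom fps set"
proof
  show "(0 :: 'a fps) \<in> range fps_of_poly" "(1 :: 'a fps) \<in> range fps_of_poly"
    by (metis fps_of_poly_0 rangeI, metis fps_of_poly_1 rangeI)
next
  fix a b :: "'a fps" assume "a \<in> range fps_of_poly" "b \<in> range fps_of_poly"
  then show "a - b \<in> range fps_of_poly" "a * b \<in> range fps_of_poly"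
    by (auto simp flip: fps_of_poly_diff fps_of_poly_mult)
qed

lemma algebraic_fps_iff: "algebraic_fps F \<longleftrightarrow> poly_fps.algebraic_over F"
proof
  assume "algebraic_fps F"
  then obtain P where P: "P \<noteq> 0" "poly (map_poly fps_of_poly P) F = 0"
    by (auto simp: algebraic_fps_def)
  have "map_poly fps_of_poly P \<noteq> 0"
  proof
    assume "map_poly fps_of_poly P = 0"
    then have "fps_of_poly (coeff P i) = fps_of_poly 0" for i
      by (metis coeff_0 coeff_map_poly fps_of_poly_0)
    then have "coeff P i = 0" for i by (simp only: fps_of_poly_eq_iff)
    with P(1) show False by (simp add: poly_eq_iff)
  qed
  with P(2) show "poly_fps.algebraic_over F"
    unfolding poly_fps.algebraic_over_def
    by (intro exI [of _ "map_poly fps_of_poly P"]) (auto simp: coeff_map_poly)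
next
  assume "poly_fps.algebraic_over F"
  then obtain Q where Q: "Q \<noteq> 0" "\<And>i. coeff Q i \<in> range fps_of_poly" "poly Q F = 0"
    by (auto simp: poly_fps.algebraic_over_def)
  define g where "g = (inv fps_of_poly :: 'a fps \<Rightarrow> 'a poly)"
  have "inj (fps_of_poly :: 'a poly \<Rightarrow> _)" by (simp add: inj_def fps_of_poly_eq_iff)
  then have g0: "g 0 = 0" unfolding g_def by (metis fps_of_poly_0 inv_f_f)
  have "map_poly fps_of_poly (map_poly g Q) = Q"
  proof (rule poly_eqI)
    fix i
    show "coeff (map_poly fps_of_poly (map_poly g Q)) i = coeff Q i"
      using f_inv_into_f [OF Q(2) [of i]] by (simp add: coeff_map_poly g0) (simp add: g_def)
  qed
  with Q show "algebraic_fps F"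
    unfolding algebraic_fps_def by (intro exI [of _ "map_poly g Q"]) auto
qed

lemma algebraic_fps_root:
  "Q \<noteq> 0 \<Longrightarrow> (\<And>i. algebraic_fps (coeff Q i)) \<Longrightarrow> poly Q F = 0 \<Longrightarrow> algebraic_fps F"
  unfolding algebraic_fps_iff by (rule poly_fps.algebraic_over_root)

lemma algebraic_fps_add: "algebraic_fps F \<Longrightarrow> algebraic_fps G \<Longrightarrow> algebraic_fps (F + G)"
  and algebraic_fps_mult: "algebraic_fps F \<Longrightarrow> algebraic_fps G \<Longrightarrow> algebraic_fps (F * G)"
  and algebraic_fps_of_poly: "algebraic_fps (fps_of_poly p)"
  unfolding algebraic_fps_iff
  by (simp_all add: poly_fps.algebraic_over_add poly_fps.algebraic_over_mult poly_fps.algebraic_over_K)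

lemma algebraic_fps_range: "F \<in> range fps_of_poly \<Longrightarrow> algebraic_fps F"
  by (auto intro: algebraic_fps_of_poly)

lemma algebraic_fps_const: "algebraic_fps (fps_const c)"
  and algebraic_fps_0: "algebraic_fps (0 :: 'a :: idom fps)"
  and algebraic_fps_1: "algebraic_fps (1 :: 'a fps)"
  and algebraic_fps_X: "algebraic_fps (fps_X :: 'a fps)"
  using algebraic_fps_of_poly [of "[:c:]"] algebraic_fps_of_poly [of "0 :: 'a poly"]
    algebraic_fps_of_poly [of "1 :: 'a poly"] algebraic_fps_of_poly [of "[:0, 1 :: 'a:]"]
  by (simp_all add: fps_of_poly_const)

lemma algebraic_fps_uminus: "algebraic_fps F \<Longrightarrow> algebraic_fps (- F)"
  using algebraic_fps_mult [OF algebraic_fps_const [of "- 1"], of F]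
  by (simp flip: fps_const_neg)

lemma algebraic_fps_diff: "algebraic_fps F \<Longrightarrow> algebraic_fps G \<Longrightarrow> algebraic_fps (F - G)"
  using algebraic_fps_add [of F "- G"] algebraic_fps_uminus [of G] by simp

lemma algebraic_fps_power: "algebraic_fps F \<Longrightarrow> algebraic_fps (F ^ n)"
  by (induction n) (auto intro: algebraic_fps_1 algebraic_fps_mult)

lemmas algebraic_fps_intros =
  algebraic_fps_add algebraic_fps_mult algebraic_fps_diff algebraic_fps_uminus algebraic_fps_power
  algebraic_fps_const algebraic_fps_0 algebraic_fps_1 algebraic_fps_X algebraic_fps_of_poly

lemma algebraic_fps_quotient:
  assumes "algebraic_fps A" "algebraic_fps B" "A \<noteq> 0" "A * F = B"
  shows "algebraic_fps F"
proof (rule algebraic_fps_root)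
  show "[:- B, A:] \<noteq> 0" "poly [:- B, A:] F = 0"
    using assms by (auto simp: mult.commute)
  show "algebraic_fps (coeff [:- B, A:] i)" for i
    using assms by (auto simp: coeff_pCons intro: algebraic_fps_intros split: nat.split)
qed

lemma algebraic_fps_nth_root:
  assumes "algebraic_fps (F ^ n)" "n > 0"
  shows "algebraic_fps F"
proof (rule algebraic_fps_root)
  let ?Q = "monom 1 n - [:F ^ n:]"
  show "?Q \<noteq> 0"
  proof
    assume "?Q = 0"
    then have "coeff ?Q n = 0" by simp
    with assms(2) show False by (auto simp: coeff_pCons split: nat.splits)
  qed
  show "poly ?Q F = 0" by (simp add: poly_monom)
  show "algebraic_fps (coeff ?Q i)" for i
    using assms by (auto simp: coeff_pCons intro: algebraic_fps_intros split: nat.split)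
qed

lemma algebraic_fps_poly:
  assumes "\<And>i. algebraic_fps (coeff Q i)" "algebraic_fps F"
  shows "algebraic_fps (poly Q F)"
  using assms(1)
proof (induction Q)
  case 0
  show ?case by (simp add: algebraic_fps_0)
next
  case (pCons A Q)
  have "algebraic_fps (coeff Q i)" for i using pCons.prems [of "Suc i"] by simp
  moreover have "algebraic_fps A" using pCons.prems [of 0] by simp
  ultimately show ?case using pCons.IH assms(2) by (simp add: algebraic_fps_intros)
qed

lemma fps_deriv_poly:
  fixes F :: "'a :: idom fps"
  shows "fps_deriv (poly Q F) = poly (map_poly fps_deriv Q) F + poly (pderiv Q) F * fps_deriv F"
  by (induction Q) (simp_all add: map_poly_pCons pderiv_pCons algebra_simps)

text \<open>
  Differentiating an equation \<open>Q(F) = 0\<close> of least degree gives a linear equation for the derivative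
  of \<open>F\<close> whose leading coefficient, the value at \<open>F\<close> of the formal derivative of \<open>Q\<close>, is nonzero
  by minimality.
\<close>

lemma algebraic_fps_deriv:
  fixes F :: "'a :: {idom, ring_char_0} fps"
  assumes "algebraic_fps F"
  shows "algebraic_fps (fps_deriv F)"
proof -
  let ?A = "\<lambda>Q. Q \<noteq> 0 \<and> (\<forall>i. coeff Q i \<in> range fps_of_poly) \<and> poly Q F = 0"
  from assms have "\<exists>Q. ?A Q" by (simp add: algebraic_fps_iff poly_fps.algebraic_over_def)
  from ex_has_least_nat [of ?A _ degree] this
  obtain Q where Q: "?A Q" and min: "\<And>R. ?A R \<Longrightarrow> degree Q \<le> degree R" by metis
  have "degree Q \<noteq> 0"
  proof
    assume "degree Q = 0"
    then obtain a where "Q = [:a:]" by (rule degree_eq_zeroE)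
    with Q show False by auto
  qed
  have of_nat_range: "of_nat n \<in> range (fps_of_poly :: 'a poly \<Rightarrow> _)" for n
    by (rule image_eqI [of _ _ "[:of_nat n:]"]) (simp_all add: fps_of_poly_const fps_of_nat)
  have "poly (pderiv Q) F \<noteq> 0"
  proof
    assume "poly (pderiv Q) F = 0"
    moreover have "pderiv Q \<noteq> 0"
      using \<open>degree Q \<noteq> 0\<close> by (simp add: pderiv_eq_0_iff)
    moreover have "coeff (pderiv Q) i \<in> range fps_of_poly" for i
      using Q of_nat_range by (auto simp: coeff_pderiv simp del: of_nat_Suc intro: poly_fps.mult_K)
    ultimately have "degree Q \<le> degree (pderiv Q)" by (intro min) auto
    then show False using \<open>degree Q \<noteq> 0\<close> by (simp add: degree_pderiv)
  qed
  moreover have "poly (pderiv Q) F * fps_deriv F = - poly (map_poly fps_deriv Q) F"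
    using fps_deriv_poly [of Q F] Q by (simp add: add_eq_0_iff)
  ultimately show ?thesis
  proof (elim algebraic_fps_quotient [rotated 2])
    show "algebraic_fps (poly (pderiv Q) F)"
    proof (rule algebraic_fps_poly [OF _ assms])
      show "algebraic_fps (coeff (pderiv Q) i)" for i
        using Q by (auto simp: coeff_pderiv simp del: of_nat_Suc
            intro!: algebraic_fps_mult algebraic_fps_range of_nat_range)
    qed
    have "algebraic_fps (fps_deriv (coeff Q i))" for i
    proof -
      obtain p where "coeff Q i = fps_of_poly p" using Q by auto
      then show ?thesis by (simp add: algebraic_fps_of_poly flip: fps_of_poly_pderiv)
    qed
    then show "algebraic_fps (- poly (map_poly fps_deriv Q) F)"
      by (intro algebraic_fps_uminus algebraic_fps_poly assms) (simp add: coeff_map_poly)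
  qed
qed

lemma fps_compose_poly:
  fixes G :: "'a :: idom fps"
  assumes "fps_nth G 0 = 0"
  shows "poly Q F oo G = poly (map_poly (\<lambda>A. A oo G) Q) (F oo G)"
  by (induction Q)
    (simp_all add: map_poly_pCons fps_compose_add_distrib fps_compose_mult_distrib [OF assms])

text \<open>
  Substituting \<open>G\<close> for the variable in \<open>Q(F) = 0\<close> gives an equation for \<open>F oo G\<close> whose
  coefficients are polynomials in \<open>G\<close>. It is nontrivial because substitution of a nonzero series
  without constant term is injective.
\<close>

lemma algebraic_fps_compose:
  fixes F G :: "'a :: idom fps"
  assumes F: "algebraic_fps F" and G: "algebraic_fps G" "fps_nth G 0 = 0"
  shows "algebraic_fps (F oo G)"
proof (cases "G = 0")
  case True
  then show ?thesis by (simp add: algebraic_fps_const)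
next
  case False
  from F obtain Q where Q: "Q \<noteq> 0" "\<And>i. coeff Q i \<in> range fps_of_poly" "poly Q F = 0"
    by (auto simp: algebraic_fps_iff poly_fps.algebraic_over_def)
  let ?Q = "map_poly (\<lambda>A. A oo G) Q"
  have inner: "algebraic_fps (fps_of_poly p oo G)" for p
  proof (induction p)
    case 0
    then show ?case by (simp add: algebraic_fps_0)
  next
    case (pCons a p)
    then show ?case
      by (simp add: fps_of_poly_pCons fps_compose_add_distrib fps_compose_mult_distrib G(2)
          algebraic_fps_intros G(1))
  qed
  show ?thesis
  proof (rule algebraic_fps_root)
    show "?Q \<noteq> 0"
    proof
      assume "?Q = 0"
      then have "coeff Q i oo G = 0" for i by (metis coeff_0 coeff_map_poly fps_compose_0)
      then have "coeff Q i = 0" for i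
        using G False by (simp add: fps_compose_eq_0_iff)
      with Q(1) show False by (simp add: poly_eq_iff)
    qed
    show "poly ?Q (F oo G) = 0"
      using Q(3) by (simp add: fps_compose_poly [OF G(2), symmetric])
    show "algebraic_fps (coeff ?Q i)" for i
      using Q(2) [of i] inner by (auto simp: coeff_map_poly)
  qed
qed

definition map_fps :: "('a \<Rightarrow> 'b) \<Rightarrow> 'a fps \<Rightarrow> 'b fps" where
  "map_fps e F = Abs_fps (\<lambda>n. e (fps_nth F n))"

lemma map_fps_nth [simp]: "fps_nth (map_fps e F) n = e (fps_nth F n)"
  by (simp add: map_fps_def)

locale coeff_hom =
  fixes e :: "'a :: comm_ring_1 \<Rightarrow> 'b :: comm_ring_1"
  assumes hom_0: "e 0 = 0" and hom_1: "e 1 = 1"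
    and hom_add: "e (a + b) = e a + e b" and hom_mult: "e (a * b) = e a * e b"
begin

lemma hom_sum: "e (sum f I) = (\<Sum>i\<in>I. e (f i))"
  by (induction I rule: infinite_finite_induct) (simp_all add: hom_0 hom_add)

lemma hom_diff: "e (a - b) = e a - e b"
  using hom_add [of "a - b" b] by (simp add: algebra_simps)

lemma hom_uminus: "e (- a) = - e a"
  using hom_diff [of 0 a] by (simp add: hom_0)

lemma map_fps_0: "map_fps e 0 = 0"
  and map_fps_1: "map_fps e 1 = 1"
  and map_fps_X: "map_fps e fps_X = fps_X"
  and map_fps_const: "map_fps e (fps_const c) = fps_const (e c)"
  and map_fps_add: "map_fps e (F + G) = map_fps e F + map_fps e G"
  and map_fps_diff: "map_fps e (F - G) = map_fps e F - map_fps e G"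
  and map_fps_uminus: "map_fps e (- F) = - map_fps e F"
  and map_fps_mult: "map_fps e (F * G) = map_fps e F * map_fps e G"
  by (rule fps_ext; simp add: hom_0 hom_1 hom_add hom_diff hom_uminus hom_mult hom_sum fps_mult_nth fps_X_def)+

lemma map_fps_power: "map_fps e (F ^ n) = map_fps e F ^ n"
  by (induction n) (simp_all add: map_fps_1 map_fps_mult)

lemma map_fps_compose: "map_fps e (F oo G) = map_fps e F oo map_fps e G"
proof (rule fps_ext)
  have "e (fps_nth (G ^ i) n) = fps_nth (map_fps e G ^ i) n" for i n
    by (simp flip: map_fps_power)
  then show "fps_nth (map_fps e (F oo G)) n = fps_nth (map_fps e F oo map_fps e G) n" for n
    by (simp add: fps_compose_nth hom_sum hom_mult)
qed

end

lemma algebraic_fps_map: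
  fixes e :: "'a :: idom \<Rightarrow> 'b :: idom"
  assumes "coeff_hom e" "inj e" and F: "algebraic_fps F"
  shows "algebraic_fps (map_fps e F)"
proof -
  interpret coeff_hom e by (rule assms)
  have e_0_iff: "e a = 0 \<longleftrightarrow> a = 0" for a
    using hom_0 assms(2) by (metis injD)
  have of_poly: "map_fps e (fps_of_poly p) = fps_of_poly (map_poly e p)" for p
    by (rule fps_ext) (simp add: coeff_map_poly hom_0)
  have poly: "map_fps e (poly Q F) = poly (map_poly (map_fps e) Q) (map_fps e F)" for Q
    by (induction Q) (simp_all add: map_poly_pCons map_fps_0 map_fps_add map_fps_mult)
  from F obtain P where P: "P \<noteq> 0" "poly (map_poly fps_of_poly P) F = 0"
    by (auto simp: algebraic_fps_def)
  have "map_poly fps_of_poly (map_poly (map_poly e) P) = map_poly (map_fps e) (map_poly fps_of_poly P)"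
    by (rule poly_eqI) (simp add: coeff_map_poly of_poly map_fps_0)
  then have "poly (map_poly fps_of_poly (map_poly (map_poly e) P)) (map_fps e F) = 0"
    using poly [of "map_poly fps_of_poly P"] P(2) map_fps_0 by simp
  moreover have "map_poly (map_poly e) P \<noteq> 0"
    using P(1) by (auto simp: poly_eq_iff coeff_map_poly e_0_iff hom_0)
  ultimately show ?thesis unfolding algebraic_fps_def by blast
qed

section \<open>Complex powers of power series\<close>

lemma algebraic_fps_binomial:
  assumes "r \<in> \<rat>"
  shows "algebraic_fps (fps_binomial (r :: complex))"
proof -
  have nat: "algebraic_fps (fps_binomial (of_nat n :: complex))" for n
    by (simp add: fps_binomial_of_nat algebraic_fps_intros)
  have int: "algebraic_fps (fps_binomial (of_int k :: complex))" for k
  proof (cases "k \<ge> 0")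
    case True
    then show ?thesis using nat [of "nat k"] by simp
  next
    case False
    have "fps_binomial (of_nat (nat (- k))) * fps_binomial (of_int k) = (1 :: complex fps)"
      using False by (simp flip: fps_binomial_add_mult)
    moreover from this have "fps_binomial (of_nat (nat (- k))) \<noteq> (0 :: complex fps)"
      by (metis mult_zero_left zero_neq_one)
    ultimately show ?thesis
      using algebraic_fps_quotient [OF nat algebraic_fps_1] by blast
  qed
  from assms obtain p q where q: "q > 0" "r = of_int p / of_int q"
    by (auto elim: Rats_cases')
  have "fps_binomial r ^ nat q = fps_binomial (of_int p)"
  proof -
    have "of_nat (nat q) * r = of_int p" using q by (simp add: of_nat_nat)
    then show ?thesis by (simp add: fps_binomial_power)
  qed
  then have "algebraic_fps (fps_binomial r ^ nat q)" using int by (simp only:)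
  then show ?thesis by (rule algebraic_fps_nth_root) (use q(1) in simp)
qed

definition fps_powr :: "complex fps \<Rightarrow> complex \<Rightarrow> complex fps" where
  "fps_powr F e = fps_binomial e oo (F - 1)"

lemma fps_powr_nth_0 [simp]: "fps_nth (fps_powr F e) 0 = 1"
  by (simp add: fps_powr_def)

lemma fps_powr_deriv:
  assumes "fps_nth F 0 = 1"
  shows "F * fps_deriv (fps_powr F e) = fps_const e * fps_deriv F * fps_powr F e"
proof -
  have F: "fps_nth (F - 1) 0 = 0" using assms by simp
  have unit: "is_unit (1 + fps_X :: complex fps)" by (simp add: fps_is_unit_iff)
  have "(1 + fps_X) * fps_deriv (fps_binomial e) = fps_const e * fps_binomial e"
    by (simp only: fps_binomial_deriv dvd_mult_div_cancel unit_imp_dvd [OF unit])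
  then have "((1 + fps_X) * fps_deriv (fps_binomial e)) oo (F - 1) = (fps_const e * fps_binomial e) oo (F - 1)"
    by simp
  then have "F * (fps_deriv (fps_binomial e) oo (F - 1)) = fps_const e * fps_powr F e"
    by (simp add: fps_compose_mult_distrib [OF F] fps_compose_add_distrib fps_powr_def
        fps_X_fps_compose_startby0 [OF F])
  then show ?thesis
    by (simp add: fps_powr_def fps_compose_deriv [OF F] ac_simps)
qed

lemma algebraic_fps_powr:
  assumes "e \<in> \<rat>" "algebraic_fps F" "fps_nth F 0 = 1"
  shows "algebraic_fps (fps_powr F e)"
  unfolding fps_powr_def using assms
  by (intro algebraic_fps_compose algebraic_fps_binomial) (auto intro!: algebraic_fps_intros)

lemma fps_powr_add:
  assumes "fps_nth F 0 = 1"
  shows "fps_powr F (d + e) = fps_powr F d * fps_powr F e"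
  using assms by (simp add: fps_powr_def fps_binomial_add_mult fps_compose_mult_distrib)

lemma fps_powr_0 [simp]: "fps_powr F 0 = 1"
  by (simp add: fps_powr_def)

lemma fps_powr_1: "fps_nth F 0 = 1 \<Longrightarrow> fps_powr F 1 = F"
  by (simp add: fps_powr_def fps_binomial_1 fps_compose_add_distrib fps_X_fps_compose_startby0)

lemma fps_powr_power:
  assumes "fps_nth F 0 = 1"
  shows "fps_powr F e ^ n = fps_powr F (of_nat n * e)"
  by (induction n) (simp_all add: fps_powr_add [OF assms] ring_distribs)

lemma fps_powr_minus_1: "fps_nth F 0 = 1 \<Longrightarrow> F * fps_powr F (- 1) = 1"
  using fps_powr_add [of F 1 "- 1"] by (simp add: fps_powr_1)

section \<open>The hypergeometric equation, contiguity and Euler's transformation\<close>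

definition fps_theta :: "'a :: comm_ring_1 fps \<Rightarrow> 'a fps" where
  "fps_theta F = fps_X * fps_deriv F"

lemma fps_theta_nth [simp]: "fps_nth (fps_theta F) n = of_nat n * fps_nth F n"
  by (cases n) (simp_all add: fps_theta_def)

lemma fps_theta_mult: "fps_theta (F * G) = fps_theta F * G + F * fps_theta G"
  by (simp add: fps_theta_def algebra_simps)

text \<open>
  The hypergeometric differential equation, written with the Euler operator \<open>\<theta>\<close> as
  \<open>\<theta> (\<theta> + c - 1) F = X (\<theta> + a) (\<theta> + b) F\<close>, so that it can be read off coefficientwise as the
  two-term recurrence of the Gauss series.
\<close>

definition gauss_ode :: "complex \<Rightarrow> complex \<Rightarrow> complex \<Rightarrow> complex fps \<Rightarrow> bool" where
  "gauss_ode a b c F \<longleftrightarrow>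
     fps_theta (fps_theta F) + fps_const (c - 1) * fps_theta F =
       fps_X * (fps_theta (fps_theta F) + fps_const (a + b) * fps_theta F + fps_const (a * b) * F)"

lemma gauss_ode_iff_recurrence:
  "gauss_ode a b c F \<longleftrightarrow>
     (\<forall>n. of_nat (Suc n) * (of_nat n + c) * fps_nth F (Suc n) = (of_nat n + a) * (of_nat n + b) * fps_nth F n)"
proof -
  let ?L = "fps_theta (fps_theta F) + fps_const (c - 1) * fps_theta F"
  let ?R = "fps_theta (fps_theta F) + fps_const (a + b) * fps_theta F + fps_const (a * b) * F"
  have "gauss_ode a b c F \<longleftrightarrow> (\<forall>n. fps_nth ?L n = fps_nth (fps_X * ?R) n)"
    by (simp only: gauss_ode_def fps_eq_iff)
  also have "\<dots> \<longleftrightarrow> (\<forall>n. fps_nth ?L (Suc n) = fps_nth (fps_X * ?R) (Suc n))"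
  proof -
    have "fps_nth ?L 0 = fps_nth (fps_X * ?R) 0" by simp
    then show ?thesis by (metis nat.exhaust)
  qed
  also have "(\<lambda>n. fps_nth ?L (Suc n)) = (\<lambda>n. of_nat (Suc n) * (of_nat n + c) * fps_nth F (Suc n))"
    by (rule ext) (simp add: algebra_simps)
  also have "(\<lambda>n. fps_nth (fps_X * ?R) (Suc n)) = (\<lambda>n. (of_nat n + a) * (of_nat n + b) * fps_nth F n)"
    by (rule ext, simp) (simp add: algebra_simps)
  finally show ?thesis .
qed

abbreviation gauss_fps :: "complex \<Rightarrow> complex \<Rightarrow> complex \<Rightarrow> complex fps" where
  "gauss_fps a b c \<equiv> fps_hypergeo [a, b] [c] 1"

lemma not_Ints_add_of_nat: "c \<notin> \<int> \<Longrightarrow> c + of_nat n \<noteq> (0 :: complex)"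
  by (metis Ints_minus Ints_of_nat add_eq_0_iff2)

lemma pochhammer_not_Ints: "c \<notin> \<int> \<Longrightarrow> pochhammer c n \<noteq> (0 :: complex)"
  by (auto simp: pochhammer_eq_0_iff)

lemma gauss_fps_nth:
  "fps_nth (gauss_fps a b c) n = pochhammer a n * pochhammer b n / (pochhammer c n * fact n)"
  by simp

declare fps_hypergeo_nth [simp del]

lemma gauss_fps_Suc:
  assumes "c \<notin> \<int>"
  shows "of_nat (Suc n) * (of_nat n + c) * fps_nth (gauss_fps a b c) (Suc n)
    = (of_nat n + a) * (of_nat n + b) * fps_nth (gauss_fps a b c) n"
proof -
  have "of_nat n + c \<noteq> 0" using not_Ints_add_of_nat [OF assms, of n] by (simp add: add.commute)
  moreover have "of_nat (Suc n) \<noteq> (0 :: complex)" by (rule of_nat_neq_0)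
  moreover have "fact (Suc n) = of_nat (Suc n) * (fact n :: complex)" by (rule fact_Suc)
  ultimately show ?thesis
    using pochhammer_not_Ints [OF assms, of n]
    by (simp add: gauss_fps_nth pochhammer_rec' divide_simps add.commute del: of_nat_Suc fact_Suc)
qed

lemma gauss_ode_gauss_fps: "c \<notin> \<int> \<Longrightarrow> gauss_ode a b c (gauss_fps a b c)"
  unfolding gauss_ode_iff_recurrence using gauss_fps_Suc by blast

lemma gauss_ode_unique:
  assumes "c \<notin> \<int>" "gauss_ode a b c F" "fps_nth F 0 = 1"
  shows "F = gauss_fps a b c"
proof (rule fps_ext)
  show "fps_nth F n = fps_nth (gauss_fps a b c) n" for n
  proof (induction n)
    case (Suc n)
    have "of_nat (Suc n) * (of_nat n + c) * fps_nth F (Suc n)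
        = of_nat (Suc n) * (of_nat n + c) * fps_nth (gauss_fps a b c) (Suc n)"
      using assms(2) Suc.IH unfolding gauss_fps_Suc [OF assms(1)] gauss_ode_iff_recurrence by simp
    moreover have "of_nat n + c \<noteq> 0"
      using not_Ints_add_of_nat [OF assms(1), of n] by (simp add: add.commute)
    ultimately show ?case by (simp del: of_nat_Suc)
  qed (use assms(3) in simp)
qed

lemma gauss_fps_commute: "gauss_fps a b c = gauss_fps b a c"
  by (rule fps_ext) (simp add: gauss_fps_nth mult.commute)

text \<open>
  Gauss's contiguity relations: raising or lowering a parameter by one is a first-order differential
  operator with polynomial coefficients applied to the series, up to a constant factor.
\<close>

lemma gauss_fps_raise_upper:
  "fps_const a * gauss_fps (a + 1) b c = fps_theta (gauss_fps a b c) + fps_const a * gauss_fps a b c"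
proof (rule fps_ext)
  fix n
  have "a * pochhammer (a + 1) n = (of_nat n + a) * pochhammer a n"
    by (metis pochhammer_rec pochhammer_rec' add.commute)
  then have "a * (pochhammer (a + 1) n * q) = of_nat n * (pochhammer a n * q) + a * (pochhammer a n * q)" for q
    by algebra
  from this [of "pochhammer b n / (pochhammer c n * fact n)"]
  show "fps_nth (fps_const a * gauss_fps (a + 1) b c) n
      = fps_nth (fps_theta (gauss_fps a b c) + fps_const a * gauss_fps a b c) n"
    by (simp add: gauss_fps_nth)
qed

lemma gauss_fps_lower_upper:
  assumes c: "c \<notin> \<int>"
  shows "fps_const (c - a) * gauss_fps (a - 1) b c =
    (1 - fps_X) * fps_theta (gauss_fps a b c) + (fps_const (c - a) - fps_const b * fps_X) * gauss_fps a b c"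
  (is "?L = ?R")
proof (rule fps_ext)
  fix n
  show "fps_nth ?L n = fps_nth ?R n"
  proof (cases n)
    case 0
    then show ?thesis by (simp add: fps_mult_nth_0)
  next
    case (Suc m)
    define h where "h = fps_nth (gauss_fps a b c) m"
    define M where "M = (of_nat m :: complex)"
    define N where "N = (of_nat (Suc m) :: complex)"
    define k where "k = h / (N * (M + c))"
    have N: "N = M + 1" by (simp add: N_def M_def)
    have "M + c \<noteq> 0" using not_Ints_add_of_nat [OF c, of m] by (simp add: M_def add.commute)
    moreover have "N \<noteq> 0" unfolding N_def by (rule of_nat_neq_0)
    ultimately have nz: "N * (M + c) \<noteq> 0" by simp
    then have h: "h = N * (M + c) * k" by (simp add: k_def)
    have "N * (M + c) * fps_nth (gauss_fps a b c) (Suc m) = N * (M + c) * ((M + a) * (M + b) * k)"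
      using gauss_fps_Suc [OF c, of m a b] unfolding N_def [symmetric] M_def [symmetric] h_def [symmetric]
      by (simp only: h ac_simps)
    with nz have h1: "fps_nth (gauss_fps a b c) (Suc m) = (M + a) * (M + b) * k"
      by (metis mult_left_cancel)
    have h2: "fps_nth (gauss_fps (a - 1) b c) (Suc m) = (a - 1) * (M + b) * k"
      by (simp add: k_def h_def N_def M_def gauss_fps_nth pochhammer_rec [of "a - 1"] pochhammer_rec' [of b]
          pochhammer_rec' [of c] ac_simps)
    have "fps_nth ?L n = (c - a) * ((a - 1) * (M + b) * k)"
      using Suc by (simp add: h2)
    moreover have "fps_nth ?R n = N * ((M + a) * (M + b) * k) - M * h
        + (c - a) * ((M + a) * (M + b) * k) - b * h"
      using Suc by (simp add: left_diff_distrib mult.assoc h1 [simplified mult.assoc] h_def N_def M_def)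
    ultimately show ?thesis by (simp only: h N) (simp add: algebra_simps)
  qed
qed

lemma gauss_fps_lower_lower:
  assumes "c \<notin> \<int>"
  shows "fps_const (c - 1) * gauss_fps a b (c - 1) =
    fps_theta (gauss_fps a b c) + fps_const (c - 1) * gauss_fps a b c"
proof (rule fps_ext)
  fix n
  have eq: "(c - 1) * pochhammer c n = (of_nat n + (c - 1)) * pochhammer (c - 1) n"
    by (metis pochhammer_rec pochhammer_rec' add.commute diff_add_cancel)
  have "c - 1 \<notin> \<int>" using assms by (metis Ints_1 Ints_add diff_add_cancel)
  then have "pochhammer c n \<noteq> 0" "pochhammer (c - 1) n \<noteq> 0"
    using assms by (simp_all add: pochhammer_not_Ints)
  then have "(c - 1) * (q / pochhammer (c - 1) n) = of_nat n * (q / pochhammer c n) + (c - 1) * (q / pochhammer c n)" for q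
    using eq by (simp add: divide_simps) algebra
  from this [of "pochhammer a n * pochhammer b n / fact n"]
  show "fps_nth (fps_const (c - 1) * gauss_fps a b (c - 1)) n =
      fps_nth (fps_theta (gauss_fps a b c) + fps_const (c - 1) * gauss_fps a b c) n"
    by (simp add: gauss_fps_nth ac_simps)
qed

lemma gauss_fps_raise_lower:
  assumes c: "c \<notin> \<int>"
  shows "fps_const ((c - a) * (c - b)) * gauss_fps a b (c + 1) =
    fps_const c * ((1 - fps_X) * fps_deriv (gauss_fps a b c) - fps_const (a + b - c) * gauss_fps a b c)"
  (is "?L = ?R")
proof (rule fps_ext)
  fix n
  define h where "h = fps_nth (gauss_fps a b c) n"
  define M where "M = (of_nat n :: complex)"
  define k where "k = h / (M + c)"
  have nz: "M + c \<noteq> 0" using not_Ints_add_of_nat [OF c, of n] by (simp add: M_def add.commute)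
  then have h: "h = (M + c) * k" by (simp add: k_def)
  have "(M + c) * (of_nat (Suc n) * fps_nth (gauss_fps a b c) (Suc n)) = (M + c) * ((M + a) * (M + b) * k)"
    using gauss_fps_Suc [OF c, of n a b] unfolding M_def [symmetric] h_def [symmetric]
    by (simp add: h ac_simps)
  with nz have h1: "of_nat (Suc n) * fps_nth (gauss_fps a b c) (Suc n) = (M + a) * (M + b) * k"
    by (metis mult_left_cancel)
  have "c * pochhammer (c + 1) n = (M + c) * pochhammer c n"
    unfolding M_def by (metis pochhammer_rec pochhammer_rec' add.commute)
  moreover have "c \<noteq> 0" using c by auto
  ultimately have "pochhammer (c + 1) n = (M + c) * pochhammer c n / c"
    by (simp add: field_simps)
  then have h2: "fps_nth (gauss_fps a b (c + 1)) n = c * k"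
    by (simp add: k_def h_def gauss_fps_nth ac_simps)
  have "fps_nth ((1 - fps_X) * fps_deriv (gauss_fps a b c)) n
      = of_nat (Suc n) * fps_nth (gauss_fps a b c) (Suc n) - M * h"
    by (cases n) (simp_all add: left_diff_distrib h_def M_def)
  then have "fps_nth ?R n = c * ((M + a) * (M + b) * k - M * h - (a + b - c) * h)"
    unfolding h1 h_def by (simp only: fps_mult_left_const_nth fps_sub_nth)
  moreover have "fps_nth ?L n = (c - a) * (c - b) * (c * k)" by (simp add: h2)
  ultimately show "fps_nth ?L n = fps_nth ?R n"
    by (simp only: h) (simp add: algebra_simps)
qed

abbreviation algebraic_gauss :: "complex \<Rightarrow> complex \<Rightarrow> complex \<Rightarrow> bool" where
  "algebraic_gauss a b c \<equiv> algebraic_fps (gauss_fps a b c)"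

lemma algebraic_fps_cancel_const:
  fixes F :: "complex fps"
  shows "fps_const k * F = G \<Longrightarrow> k \<noteq> 0 \<Longrightarrow> algebraic_fps G \<Longrightarrow> algebraic_fps F"
  by (rule algebraic_fps_quotient [OF algebraic_fps_const]) auto

lemma algebraic_fps_theta: "algebraic_fps F \<Longrightarrow> algebraic_fps (fps_theta F)" for F :: "complex fps"
  by (simp add: fps_theta_def algebraic_fps_intros algebraic_fps_deriv)

lemmas algebraic_gauss_intros = algebraic_fps_intros algebraic_fps_theta algebraic_fps_deriv

text \<open>
  Irreducibility of the hypergeometric equation, together with \<open>c \<notin> \<int>\<close>. The condition is invariant
  under integer shifts of the parameters, and it keeps the constant factors in all contiguity
  relations nonzero.
\<close>

definition nonresonant :: "complex \<Rightarrow> complex \<Rightarrow> complex \<Rightarrow> bool" where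
  "nonresonant a b c \<longleftrightarrow> a \<notin> \<int> \<and> b \<notin> \<int> \<and> c \<notin> \<int> \<and> c - a \<notin> \<int> \<and> c - b \<notin> \<int>"

lemma add_Ints_notin_Ints: "z \<notin> \<int> \<Longrightarrow> k \<in> \<int> \<Longrightarrow> z + k \<notin> \<int>" for z k :: complex
  by (metis Ints_diff add_diff_cancel_right')

lemma nonresonant_shift:
  assumes "nonresonant a b c"
  shows "nonresonant (a + of_int i) (b + of_int j) (c + of_int k)"
proof -
  have "c + of_int k - (a + of_int i) = (c - a) + of_int (k - i)"
    "c + of_int k - (b + of_int j) = (c - b) + of_int (k - j)" by simp_all
  with assms show ?thesis unfolding nonresonant_def by (metis add_Ints_notin_Ints Ints_of_int)
qed

lemma algebraic_gauss_raise_upper: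
  "nonresonant a b c \<Longrightarrow> algebraic_gauss a b c \<Longrightarrow> algebraic_gauss (a + 1) b c"
  by (rule algebraic_fps_cancel_const [OF gauss_fps_raise_upper])
    (auto simp: nonresonant_def intro!: algebraic_gauss_intros)

lemma algebraic_gauss_lower_upper:
  "nonresonant a b c \<Longrightarrow> algebraic_gauss a b c \<Longrightarrow> algebraic_gauss (a - 1) b c"
  by (rule algebraic_fps_cancel_const [OF gauss_fps_lower_upper])
    (auto simp: nonresonant_def intro!: algebraic_gauss_intros)

lemma algebraic_gauss_raise_lower:
  "nonresonant a b c \<Longrightarrow> algebraic_gauss a b c \<Longrightarrow> algebraic_gauss a b (c + 1)"
  by (rule algebraic_fps_cancel_const [OF gauss_fps_raise_lower])
    (auto simp: nonresonant_def intro!: algebraic_gauss_intros)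

lemma algebraic_gauss_lower_lower:
  "nonresonant a b c \<Longrightarrow> algebraic_gauss a b c \<Longrightarrow> algebraic_gauss a b (c - 1)"
  by (rule algebraic_fps_cancel_const [OF gauss_fps_lower_lower])
    (auto simp: nonresonant_def intro!: algebraic_gauss_intros)

lemma int_shift_induct:
  fixes P :: "complex \<Rightarrow> bool"
  assumes "P z" and "\<And>k. P (z + of_int k) \<Longrightarrow> P (z + of_int k + 1)"
    "\<And>k. P (z + of_int k) \<Longrightarrow> P (z + of_int k - 1)"
  shows "P (z + of_int k)"
proof (induction k rule: int_induct [of _ 0])
  case base
  show ?case using assms(1) by simp
next
  case (step1 i)
  then show ?case using assms(2) [of i] by (simp add: add.assoc)
next
  case (step2 i)
  then show ?case using assms(3) [of i] by (simp add: add_diff_eq)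
qed

text \<open>
  Algebraic series are closed under differentiation, so each contiguity step preserves algebraicity;
  it suffices to treat one representative of each class of parameters modulo the integers.
\<close>

theorem algebraic_gauss_contiguous:
  assumes "nonresonant a b c" "algebraic_gauss a b c"
  shows "algebraic_gauss (a + of_int i) (b + of_int j) (c + of_int k)"
proof -
  have nr: "nonresonant (a + of_int i) (b + of_int j) (c + of_int k)" for i j k
    by (rule nonresonant_shift [OF assms(1)])
  have upper: "algebraic_gauss (a + of_int i) b' c'"
    if "algebraic_gauss a b' c'" "\<And>i. nonresonant (a + of_int i) b' c'" for a b' c' i
    by (rule int_shift_induct [of "\<lambda>a. algebraic_gauss a b' c'"])
      (use that in \<open>auto intro: algebraic_gauss_raise_upper algebraic_gauss_lower_upper\<close>)
  have 1: "algebraic_gauss a b (c + of_int k)"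
    by (rule int_shift_induct [of "\<lambda>c. algebraic_gauss a b c"])
      (use nr [of 0 0] assms(2) in \<open>auto intro: algebraic_gauss_raise_lower algebraic_gauss_lower_lower\<close>)
  have 2: "algebraic_gauss (a + of_int i) b (c + of_int k)"
    by (rule upper [OF 1]) (use nr [of _ 0 k] in simp)
  have "algebraic_gauss (b + of_int j) (a + of_int i) (c + of_int k)"
  proof (rule upper)
    show "algebraic_gauss b (a + of_int i) (c + of_int k)"
      using 2 by (subst gauss_fps_commute)
    show "nonresonant (b + of_int j) (a + of_int i) (c + of_int k)" for j
      using nr [of i j k] by (auto simp: nonresonant_def)
  qed
  then show ?thesis by (subst gauss_fps_commute)
qed

text \<open>
  Euler's transformation. The right-hand side is shown to satisfy the equation of the left-hand side;
  with \<open>\<theta> w = - e X w / (1 - X)\<close> for the power \<open>w\<close>, multiplying that equation by \<open>1 - X\<close> reduces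
  it to a multiple of the equation for the second Gauss series.
\<close>

theorem gauss_fps_euler:
  assumes c: "c \<notin> \<int>"
  shows "gauss_fps a b c = fps_powr (1 - fps_X) (c - a - b) * gauss_fps (c - a) (c - b) c"
proof -
  define e where "e = c - a - b"
  define w where "w = fps_powr (1 - fps_X) e"
  define G where "G = gauss_fps (c - a) (c - b) c"
  define Y where "Y = w * G"
  let ?\<theta> = "fps_theta"
  have w: "(1 - fps_X) * ?\<theta> w = - fps_const e * fps_X * w"
  proof -
    have "(1 - fps_X) * fps_deriv w = - fps_const e * w"
      unfolding w_def by (subst fps_powr_deriv) simp_all
    then show ?thesis by (metis fps_theta_def mult.left_commute mult.assoc)
  qed
  have ode: "?\<theta> (?\<theta> G) + fps_const (c - 1) * ?\<theta> G = fps_X * (?\<theta> (?\<theta> G)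
      + fps_const (c - a + (c - b)) * ?\<theta> G + fps_const ((c - a) * (c - b)) * G)"
    using gauss_ode_gauss_fps [OF c, of "c - a" "c - b"] by (simp add: gauss_ode_def G_def)
  define V where "V = (1 - fps_X) * ?\<theta> G - fps_const e * fps_X * G"
  have Z: "(1 - fps_X) * ?\<theta> Y = w * V"
    unfolding Y_def V_def fps_theta_mult using w by algebra
  have \<theta>1: "?\<theta> (1 - fps_X) = - fps_X" by (simp add: fps_theta_def)
  have \<theta>V: "?\<theta> V = - fps_X * ?\<theta> G + (1 - fps_X) * ?\<theta> (?\<theta> G) - fps_const e * fps_X * (G + ?\<theta> G)"
    unfolding V_def by (simp add: fps_theta_def algebra_simps)
  have "?\<theta> ((1 - fps_X) * ?\<theta> Y) = ?\<theta> (w * V)" by (simp only: Z)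
  then have Z': "- fps_X * ?\<theta> Y + (1 - fps_X) * ?\<theta> (?\<theta> Y) = ?\<theta> w * V + w * ?\<theta> V"
    by (simp only: fps_theta_mult \<theta>1)
  let ?D = "?\<theta> (?\<theta> Y) + fps_const (c - 1) * ?\<theta> Y
    - fps_X * (?\<theta> (?\<theta> Y) + fps_const (a + b) * ?\<theta> Y + fps_const (a * b) * Y)"
  have "(1 - fps_X) * ?D = 0"
  proof -
    define A B C where "A = fps_const a" and "B = fps_const b" and "C = fps_const c"
    have expand: "fps_const e = C - A - B" "fps_const (c - 1) = C - 1" "fps_const (a + b) = A + B"
      "fps_const (a * b) = A * B" "fps_const (c - a + (c - b)) = C - A + (C - B)"
      "fps_const ((c - a) * (c - b)) = (C - A) * (C - B)"
      by (simp_all add: A_def B_def C_def e_def flip: fps_const_sub fps_const_add fps_const_mult fps_const_1_eq_1)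
    have 1: "(1 - fps_X) * ((1 - fps_X) * ?\<theta> (?\<theta> Y))
        = w * (- (C - A - B) * fps_X * V + (1 - fps_X) * ?\<theta> V + fps_X * V)"
      using Z Z' w unfolding expand by algebra
    have 2: "- (C - A - B) * fps_X * V + (1 - fps_X) * ?\<theta> V + fps_X * V
        + (C - 1 - (A + B) * fps_X) * V - A * B * fps_X * (1 - fps_X) * G = 0"
      unfolding \<theta>V unfolding V_def using ode unfolding expand by algebra
    show ?thesis
      using 1 2 Z Y_def unfolding expand by algebra
  qed
  then have "?D = 0"
    by (metis fps_X_neq_one eq_iff_diff_eq_0 mult_eq_0_iff)
  then have "gauss_ode a b c Y" by (simp add: gauss_ode_def)
  moreover have "fps_nth Y 0 = 1" by (simp add: Y_def w_def G_def)
  ultimately have "Y = gauss_fps a b c" by (intro gauss_ode_unique c)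
  then show ?thesis by (simp add: Y_def w_def G_def e_def)
qed

section \<open>Algebraic Gauss series from rational coverings\<close>

text \<open>
  A criterion for an evaluation \<open>F(r(s)) = g(s)\<close> of the Gauss series \<open>F\<close>: the series \<open>G1\<close> and
  \<open>G2\<close> are \<open>\<theta> F\<close> and \<open>\<theta> (\<theta> F)\<close> pulled back along \<open>r\<close>, because \<open>\<theta>\<close> becomes
  \<open>(r / r') d/ds\<close>. Since \<open>r\<close> is invertible under composition, the pulled back equation transfers to
  \<open>g oo fps_inv r\<close>, and the equation has only one solution with constant term \<open>1\<close>.
\<close>

lemma gauss_fps_compose_eqI:
  assumes r: "fps_nth r 0 = 0" "fps_nth r 1 \<noteq> 0" and c: "c \<notin> \<int>" and g: "fps_nth g 0 = 1"
    and G1: "fps_deriv r * G1 = r * fps_deriv g"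
    and G2: "fps_deriv r * G2 = r * fps_deriv G1"
    and ode: "G2 + fps_const (c - 1) * G1 = r * (G2 + fps_const (a + b) * G1 + fps_const (a * b) * g)"
  shows "gauss_fps a b c oo r = g"
proof -
  define s where "s = fps_inv r"
  have s0: "fps_nth s 0 = 0" by (simp add: s_def fps_inv_def)
  have sr: "s oo r = fps_X" unfolding s_def using r by (rule fps_inv)
  have "fps_nth (fps_deriv r) 0 \<noteq> 0" using r by simp
  then have r': "fps_deriv r \<noteq> 0" by (metis fps_zero_nth)
  have theta: "fps_theta F oo r = H" if "F oo r = G" "fps_deriv r * H = r * fps_deriv G" for F G H
  proof -
    have "fps_deriv r * (fps_theta F oo r) = r * fps_deriv (F oo r)"
      by (simp add: fps_theta_def fps_compose_mult_distrib [OF r(1)] fps_compose_deriv [OF r(1)]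
          fps_X_fps_compose_startby0 [OF r(1)] ac_simps)
    with that have "fps_deriv r * (fps_theta F oo r) = fps_deriv r * H" by simp
    with r' show ?thesis by simp
  qed
  define Y where "Y = g oo s"
  have Y: "Y oo r = g"
    unfolding Y_def by (simp add: fps_compose_assoc [OF r(1) s0, symmetric] sr)
  have Y1: "fps_theta Y oo r = G1" by (rule theta [OF Y G1])
  have Y2: "fps_theta (fps_theta Y) oo r = G2" by (rule theta [OF Y1 G2])
  have "(fps_theta (fps_theta Y) + fps_const (c - 1) * fps_theta Y) oo r =
    (fps_X * (fps_theta (fps_theta Y) + fps_const (a + b) * fps_theta Y + fps_const (a * b) * Y)) oo r"
    using ode by (simp only: fps_compose_mult_distrib [OF r(1)] fps_compose_add_distrib Y Y1 Y2
        fps_X_fps_compose_startby0 [OF r(1)] fps_const_compose)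
  then have "gauss_ode a b c Y"
    unfolding gauss_ode_def by (rule iffD1 [OF fps_compose_inj_right [OF r]])
  moreover have "fps_nth Y 0 = 1" using g by (simp add: Y_def)
  ultimately have "Y = gauss_fps a b c" using c by (intro gauss_ode_unique)
  with Y show ?thesis by simp
qed

lemma algebraic_fps_inv_rational:
  fixes r :: "complex fps"
  assumes r: "fps_nth r 0 = 0" "fps_nth r 1 \<noteq> 0" and eq: "fps_of_poly D * r = fps_of_poly N" "D \<noteq> 0"
  shows "algebraic_fps (fps_inv r)"
proof (rule algebraic_fps_root)
  let ?s = "fps_inv r"
  have s0: "fps_nth ?s 0 = 0" by (simp add: fps_inv_def)
  have rs: "r oo ?s = fps_X" using r by (rule fps_inv_right)
  let ?Q = "map_poly fps_const N - smult fps_X (map_poly fps_const D)"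
  have comp: "poly (map_poly fps_const p) ?s = fps_of_poly p oo ?s" for p
    by (induction p) (simp_all add: map_poly_pCons fps_of_poly_pCons fps_compose_add_distrib
        fps_compose_mult_distrib [OF s0] fps_X_fps_compose_startby0 [OF s0])
  have "fps_of_poly N oo ?s = (fps_of_poly D oo ?s) * fps_X"
    by (simp flip: eq(1) add: fps_compose_mult_distrib [OF s0] rs)
  then show "poly ?Q ?s = 0" by (simp add: comp mult.commute)
  show "?Q \<noteq> 0"
  proof
    assume "?Q = 0"
    then have "fps_const (coeff N i) = fps_X * fps_const (coeff D i)" for i
      by (metis coeff_diff coeff_smult coeff_map_poly coeff_0 fps_const_0_eq_0 eq_iff_diff_eq_0)
    then have "fps_nth (fps_const (coeff N i)) 1 = fps_nth (fps_X * fps_const (coeff D i)) 1" for i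
      by (simp only:)
    then have "D = 0" by (simp add: poly_eq_iff)
    with eq(2) show False by simp
  qed
  show "algebraic_fps (coeff ?Q i)" for i
    by (simp add: coeff_map_poly algebraic_fps_intros)
qed

lemma fps_mult_deriv_power:
  fixes F :: "'a :: comm_ring_1 fps"
  shows "F * fps_deriv (F ^ n) = fps_const (of_nat n) * fps_deriv F * F ^ n"
proof (induction n)
  case (Suc n)
  have "F * fps_deriv (F ^ Suc n) = fps_deriv F * F ^ Suc n + F * (F * fps_deriv (F ^ n))"
    by (simp add: algebra_simps)
  also have "\<dots> = (1 + fps_const (of_nat n)) * fps_deriv F * F ^ Suc n"
    unfolding Suc.IH by (simp add: algebra_simps)
  also have "1 + fps_const (of_nat n) = fps_const (of_nat (Suc n) :: 'a)"
    by (simp flip: fps_const_add)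
  finally show ?case .
qed simp

text \<open>
  The numerator of the logarithmic derivative of \<open>q powr (2 a) * A powr (- \<epsilon>)\<close> over the common
  denominator \<open>A q\<close>.
\<close>

definition darboux_numerator :: "complex poly \<Rightarrow> complex poly \<Rightarrow> complex \<Rightarrow> complex \<Rightarrow> complex poly" where
  "darboux_numerator A q a \<epsilon> = smult (2 * a) (A * pderiv q) - smult \<epsilon> (pderiv A * q)"

text \<open>
  The data of a rational map \<open>r = \<kappa> s A ^ m / q ^ 2\<close> with \<open>1 - r = D ^ Suc k / q ^ 2\<close>: it has order
  \<open>m\<close> over \<open>0\<close> at the zeros of \<open>A\<close>, order \<open>Suc k\<close> over \<open>1\<close> at the zeros of \<open>D\<close> and order \<open>2\<close>
  over infinity at the zeros of \<open>q\<close>, and it is unramified at \<open>s = 0\<close>. The identity for \<open>D ^ k\<close> says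
  that \<open>r' = \<kappa> A ^ (m - 1) D ^ k / q ^ 3\<close>. The last identity is the hypergeometric equation for
  \<open>q powr (2 a) * A powr (- \<epsilon>)\<close> as a function of \<open>r\<close>, after its common factors have been cancelled.
\<close>

locale darboux_covering =
  fixes A q D :: "complex poly" and a b c \<epsilon> \<kappa> :: complex and k m :: nat
  assumes norm: "coeff A 0 = 1" "coeff q 0 = 1" "\<kappa> \<noteq> 0" and c: "c \<notin> \<int>" and rat: "a \<in> \<rat>" "\<epsilon> \<in> \<rat>"
    and branch_1: "q ^ 2 - smult \<kappa> ([:0, 1:] * A ^ m) = D ^ Suc k"
    and ramification: "(A + smult (of_nat m) ([:0, 1:] * pderiv A)) * q - smult 2 ([:0, 1:] * A * pderiv q) = D ^ k"
    and ode: "(A * q * pderiv ([:0, 1:] * darboux_numerator A q a \<epsilon>) + [:0, 1:] * darboux_numerator A q a \<epsilon> ^ 2) * D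
        - smult (of_nat k) ([:0, 1:] * A * q * darboux_numerator A q a \<epsilon> * pderiv D)
        + (smult (c - 1) (q ^ 2) - smult ((a + b) * \<kappa>) ([:0, 1:] * A ^ m)) * darboux_numerator A q a \<epsilon>
      = smult (a * b * \<kappa>) (A ^ m * D ^ k)"
begin

definition r :: "complex fps" where
  "r = fps_const \<kappa> * fps_X * fps_of_poly A ^ m * inverse (fps_of_poly q ^ 2)"

lemma r_nth: "fps_nth r 0 = 0" "fps_nth r 1 \<noteq> 0"
  using norm by (simp_all add: r_def fps_mult_nth_1 fps_nth_power_0 fps_mult_nth_0)

lemma r_mult_denominator:
  "r * fps_of_poly q ^ 2 = fps_const \<kappa> * fps_X * fps_of_poly A ^ m"
proof -
  have "inverse (fps_of_poly q ^ 2) * fps_of_poly q ^ 2 = 1"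
    by (rule inverse_mult_eq_1) (simp add: norm fps_nth_power_0)
  then show ?thesis unfolding r_def by (simp only: mult.assoc mult_1_right)
qed

lemma darboux_evaluation:
  "gauss_fps a b c oo r = fps_powr (fps_of_poly q) (2 * a) * fps_powr (fps_of_poly A) (- \<epsilon>)"
proof -
  define A' Q D' L' where fs: "A' = fps_of_poly A" "Q = fps_of_poly q" "D' = fps_of_poly D" "L' = fps_of_poly (darboux_numerator A q a \<epsilon>)"
  let ?X = "fps_X :: complex fps" and ?c = "fps_const :: complex \<Rightarrow> _"
  have nth_0: "fps_nth A' 0 = 1" "fps_nth Q 0 = 1" using norm by (simp_all add: fs)
  have trans: "fps_of_poly p = fps_of_poly p'" if "p = p'" for p p' :: "complex poly" using that by simp
  note tr = fps_of_poly_diff fps_of_poly_add fps_of_poly_mult fps_of_poly_smult fps_of_poly_power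
    fps_of_poly_pderiv fps_of_poly_fps_X fs [symmetric]
  define W S where "W = A' ^ m" and "S = D' ^ k"
  have E: "Q ^ 2 - ?c \<kappa> * (?X * W) = D' * S"
    using trans [OF branch_1] by (simp only: tr power_Suc W_def S_def)
  have T: "(A' + ?c (of_nat m) * (?X * fps_deriv A')) * Q - 2 * (?X * A' * fps_deriv Q) = S"
    using trans [OF ramification] by (simp only: tr S_def fps_numeral_fps_const)
  have F: "(A' * Q * fps_deriv (?X * L') + ?X * L' ^ 2) * D' - ?c (of_nat k) * (?X * A' * Q * L' * fps_deriv D')
        + (?c (c - 1) * Q ^ 2 - ?c (a + b) * ?c \<kappa> * (?X * W)) * L'
      = ?c (a * b) * ?c \<kappa> * (W * S)"
    using trans [OF ode] by (simp only: tr W_def S_def fps_const_mult)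
  have rQ: "r * Q ^ 2 = ?c \<kappa> * ?X * W"
    unfolding fs W_def by (rule r_mult_denominator)
  define g where "g = fps_powr Q (2 * a) * fps_powr A' (- \<epsilon>)"
  have g0: "fps_nth g 0 = 1" by (simp add: g_def)
  have g': "A' * Q * fps_deriv g = L' * g"
  proof -
    have L: "L' = ?c (2 * a) * (A' * fps_deriv Q) - ?c \<epsilon> * (fps_deriv A' * Q)"
      by (simp only: fs(4) darboux_numerator_def tr)
    have e: "?c (- \<epsilon>) = - ?c \<epsilon>" by simp
    from fps_powr_deriv [OF nth_0(2), of "2 * a"] fps_powr_deriv [OF nth_0(1), of "- \<epsilon>"]
    show ?thesis unfolding g_def L fps_deriv_mult e by algebra
  qed
  have Q0: "Q ^ 2 \<noteq> 0" using nth_0 by auto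
  \<comment> \<open>This is \<open>r / r' = X A q / D ^ k\<close>, from the ramification identity.\<close>
  have r': "fps_deriv r * (?X * A' * Q) = r * S"
  proof -
    have pow: "A' * fps_deriv W = ?c (of_nat m) * fps_deriv A' * W"
      unfolding W_def by (rule fps_mult_deriv_power)
    have "fps_deriv (r * Q ^ 2) = fps_deriv (?c \<kappa> * ?X * W)" by (simp only: rQ)
    then have "fps_deriv r * Q ^ 2 + r * (2 * Q * fps_deriv Q) = ?c \<kappa> * (W + ?X * fps_deriv W)"
      by (simp add: power2_eq_square algebra_simps)
    with pow rQ T have "Q ^ 2 * (fps_deriv r * (?X * A' * Q)) = Q ^ 2 * (r * S)"
      by algebra
    with Q0 show ?thesis by simp
  qed
  have "fps_nth S 0 = 1"
    unfolding T [symmetric] by (simp add: nth_0 fps_mult_nth_0)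
  then have S0: "S \<noteq> 0" and SS: "S * inverse S = 1"
    by (auto intro: inverse_mult_eq_1')
  have S': "D' * fps_deriv S = ?c (of_nat k) * fps_deriv D' * S"
    unfolding S_def by (rule fps_mult_deriv_power)
  \<comment> \<open>The pullbacks of \<open>\<theta> F\<close> and \<open>\<theta> (\<theta> F)\<close>, computed with \<open>r / r'\<close> as above.\<close>
  define G1 where "G1 = ?X * L' * g * inverse S"
  define G2 where "G2 = ?X * A' * Q * fps_deriv G1 * inverse S"
  have G1: "S * G1 = ?X * L' * g" and G2: "S * G2 = ?X * A' * Q * fps_deriv G1"
    unfolding G1_def G2_def using SS by algebra+
  have "S * (fps_deriv r * G1) = S * (r * fps_deriv g)"
    using G1 g' r' by algebra
  then have 1: "fps_deriv r * G1 = r * fps_deriv g" using S0 by simp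
  have "S * (fps_deriv r * G2) = S * (r * fps_deriv G1)"
    using G2 r' by algebra
  then have 2: "fps_deriv r * G2 = r * fps_deriv G1" using S0 by simp
  define M where "M = (A' * Q * fps_deriv (?X * L') + ?X * L' ^ 2) * D'
    - ?c (of_nat k) * (?X * A' * Q * L' * fps_deriv D')"
  have DSG2: "D' * S * S * G2 = ?X * g * M"
  proof -
    have "fps_deriv (S * G1) = fps_deriv (?X * L' * g)" by (simp only: G1)
    then have "fps_deriv S * G1 + S * fps_deriv G1 = fps_deriv (?X * L') * g + ?X * L' * fps_deriv g"
      by (simp only: fps_deriv_mult) algebra
    then show ?thesis using G1 G2 g' S' unfolding M_def by algebra
  qed
  have "Q ^ 2 * S * (G2 + ?c (c - 1) * G1 - r * (G2 + ?c (a + b) * G1 + ?c (a * b) * g)) = 0"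
  proof -
    have F': "M + (?c (c - 1) * Q ^ 2 - ?c (a + b) * ?c \<kappa> * (?X * W)) * L' = ?c (a * b) * ?c \<kappa> * (W * S)"
      using F unfolding M_def .
    show ?thesis using F' E DSG2 G1 rQ by algebra
  qed
  then have ode': "G2 + ?c (c - 1) * G1 = r * (G2 + ?c (a + b) * G1 + ?c (a * b) * g)"
    using Q0 S0 by simp
  show ?thesis
    using gauss_fps_compose_eqI [OF r_nth c g0 1 2 ode'] by (simp add: g_def fs)
qed

text \<open>
  The series is the algebraic function \<open>q powr (2 a) * A powr (- \<epsilon>)\<close> composed with the compositional
  inverse of \<open>r\<close>, and that inverse is algebraic because \<open>r\<close> is rational.
\<close>

lemma algebraic_gauss_covering: "algebraic_gauss a b c"
proof -
  let ?g = "fps_powr (fps_of_poly q) (2 * a) * fps_powr (fps_of_poly A) (- \<epsilon>)"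
  have "fps_of_poly (q ^ 2) * r = fps_of_poly (smult \<kappa> ([:0, 1:] * A ^ m))"
    using r_mult_denominator by (simp add: fps_of_poly_simps ac_simps)
  moreover have "q ^ 2 \<noteq> 0" using norm by auto
  ultimately have inv: "algebraic_fps (fps_inv r)"
    using r_nth by (intro algebraic_fps_inv_rational)
  have inv0: "fps_nth (fps_inv r) 0 = 0" by (simp add: fps_inv_def)
  have ri: "r oo fps_inv r = fps_X" using r_nth by (rule fps_inv_right)
  have "algebraic_fps ?g"
    using norm rat by (intro algebraic_fps_mult algebraic_fps_powr algebraic_fps_of_poly) auto
  then have "algebraic_fps (?g oo fps_inv r)"
    using inv inv0 by (intro algebraic_fps_compose)
  also have "?g = gauss_fps a b c oo r"
    by (rule darboux_evaluation [symmetric])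
  also have "gauss_fps a b c oo r oo fps_inv r = gauss_fps a b c"
    using fps_compose_assoc [OF inv0 r_nth(1), of "gauss_fps a b c"] ri by simp
  finally show ?thesis .
qed

end

text \<open>
  The equations below have local exponent differences \<open>1/3\<close> or \<open>1/4\<close> at \<open>0\<close> (with either sign),
  \<open>1/3\<close> or \<open>1/4\<close> at \<open>1\<close>, and \<open>1/2\<close> at infinity, so their projective monodromy groups are
  tetrahedral or octahedral. The local monodromy at \<open>0\<close> generates the stabilizer of the line spanned
  by the Gauss series, a cyclic group of order \<open>m = 3\<close> or \<open>m = 4\<close>, and \<open>r\<close> is the corresponding
  covering, of degree \<open>12/3\<close>, \<open>24/4\<close> or \<open>24/3\<close>. The second solution at \<open>0\<close> spans a line with the
  same stabilizer; dividing it by \<open>r powr (1/m)\<close>, with \<open>1/m\<close> its exponent, gives the evaluation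
  with \<open>\<epsilon> = 1\<close>.
\<close>

lemma algebraic_gauss_tetrahedral: "algebraic_gauss (-1/12) (5/12) (2/3)"
  by (rule darboux_covering.algebraic_gauss_covering [where A = "[:1, 1:]" and q = "[:1, 20, -8:]" and D = "[:1, -8:]"
        and m = 3 and k = 2 and \<kappa> = "64" and \<epsilon> = 0]; unfold_locales)
    (simp_all add: darboux_numerator_def pderiv_pCons power2_eq_square power3_eq_cube eval_nat_numeral)

lemma algebraic_gauss_tetrahedral_conj: "algebraic_gauss (1/4) (3/4) (4/3)"
  by (rule darboux_covering.algebraic_gauss_covering [where A = "[:1, 1:]" and q = "[:1, 20, -8:]" and D = "[:1, -8:]"
        and m = 3 and k = 2 and \<kappa> = "64" and \<epsilon> = 1]; unfold_locales)
    (simp_all add: darboux_numerator_def pderiv_pCons power2_eq_square power3_eq_cube eval_nat_numeral)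

lemma algebraic_gauss_octahedral_4: "algebraic_gauss (-1/24) (11/24) (3/4)"
  by (rule darboux_covering.algebraic_gauss_covering [where A = "[:1, -1:]" and q = "[:1, -33, -33, 1:]" and D = "[:1, 14, 1:]"
        and m = 4 and k = 2 and \<kappa> = "-108" and \<epsilon> = 0]; unfold_locales)
    (simp_all add: darboux_numerator_def pderiv_pCons power2_eq_square power3_eq_cube eval_nat_numeral)

lemma algebraic_gauss_octahedral_4_conj: "algebraic_gauss (5/24) (17/24) (5/4)"
  by (rule darboux_covering.algebraic_gauss_covering [where A = "[:1, -1:]" and q = "[:1, -33, -33, 1:]" and D = "[:1, 14, 1:]"
        and m = 4 and k = 2 and \<kappa> = "-108" and \<epsilon> = 1]; unfold_locales)
    (simp_all add: darboux_numerator_def pderiv_pCons power2_eq_square power3_eq_cube eval_nat_numeral)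

lemma algebraic_gauss_octahedral_3: "algebraic_gauss (-1/24) (11/24) (2/3)"
  by (rule darboux_covering.algebraic_gauss_covering [where A = "[:1, -7, -8:]" and q = "[:1, -88, 0, -704, -64:]" and D = "[:1, 20, -8:]"
        and m = 3 and k = 3 and \<kappa> = "-256" and \<epsilon> = 0]; unfold_locales)
    (simp_all add: darboux_numerator_def pderiv_pCons power2_eq_square power3_eq_cube eval_nat_numeral)

lemma algebraic_gauss_octahedral_3_conj: "algebraic_gauss (7/24) (19/24) (4/3)"
  by (rule darboux_covering.algebraic_gauss_covering [where A = "[:1, -7, -8:]" and q = "[:1, -88, 0, -704, -64:]" and D = "[:1, 20, -8:]"
        and m = 3 and k = 3 and \<kappa> = "-256" and \<epsilon> = 1]; unfold_locales)
    (simp_all add: darboux_numerator_def pderiv_pCons power2_eq_square power3_eq_cube eval_nat_numeral)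

section \<open>Taylor coefficients of the Gegenbauer generating series\<close>

definition gegenbauer_coeff :: "complex \<Rightarrow> nat \<Rightarrow> nat \<Rightarrow> complex" where
  "gegenbauer_coeff lam j k = (if 2 * k \<le> j then
     pochhammer (2 * lam) j / (4 ^ k * fact k * pochhammer (lam + 1/2) k * fact (j - 2 * k)) else 0)"

text \<open>
  The equation \<open>(j + 1) H (j + 1) = 2 lam P (H j) + (H j)'\<close> for the polynomials \<open>H j\<close> with these
  coefficients, compared monomial by monomial.
\<close>

lemma gegenbauer_coeff_Suc:
  assumes c: "lam + 1/2 \<notin> \<int>"
  shows "of_nat (Suc j) * gegenbauer_coeff lam (Suc j) k =
    (2 * lam + of_nat (j + 2 * k)) * gegenbauer_coeff lam j k +
    (case k of 0 \<Rightarrow> 0 | Suc l \<Rightarrow> of_nat (j - 2 * l) * gegenbauer_coeff lam j l)"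
proof (cases "2 * k \<le> Suc j")
  case False
  then show ?thesis by (cases k) (auto simp: gegenbauer_coeff_def)
next
  case True
  then obtain i where i: "Suc j = 2 * k + i" using le_Suc_ex by blast
  define p where "p = pochhammer (2 * lam) j"
  define w where "w = 4 ^ k * fact k * pochhammer (lam + 1/2) k * (fact i :: complex)"
  have w: "w \<noteq> 0" using pochhammer_not_Ints [OF c] by (simp add: w_def)
  have j: "of_nat j = 2 * of_nat k + of_nat i - (1 :: complex)"
    using arg_cong [OF i, of "of_nat :: nat \<Rightarrow> complex"] by (simp add: algebra_simps)
  have e1: "gegenbauer_coeff lam (Suc j) k = (2 * lam + of_nat j) * p / w"
  proof -
    have "Suc j - 2 * k = i" using i by simp
    then show ?thesis
      unfolding gegenbauer_coeff_def pochhammer_rec' p_def w_def using True by simp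
  qed
  have e2: "gegenbauer_coeff lam j k = of_nat i * p / w"
  proof (cases i)
    case 0
    then show ?thesis using i by (simp add: gegenbauer_coeff_def)
  next
    case (Suc i')
    with i have "2 * k \<le> j" "j - 2 * k = i'" by auto
    moreover have "(fact i :: complex) = of_nat i * fact i'" using Suc by simp
    moreover have "(of_nat i :: complex) \<noteq> 0" using Suc by (simp del: of_nat_Suc)
    ultimately show ?thesis using w
      by (simp add: gegenbauer_coeff_def p_def w_def divide_simps)
  qed
  have e3: "(case k of 0 \<Rightarrow> 0 | Suc l \<Rightarrow> of_nat (j - 2 * l) * gegenbauer_coeff lam j l)
      = 4 * of_nat k * (lam + of_nat k - 1/2) * p / w"
  proof (cases k)
    case (Suc l)
    with i have jl: "j - 2 * l = Suc i" "2 * l \<le> j" by auto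
    have f: "(fact (Suc i) :: complex) = of_nat (Suc i) * fact i" "(fact k :: complex) = of_nat k * fact l"
      using Suc by simp_all
    have ph: "pochhammer (lam + 1/2) k = (lam + of_nat k - 1/2) * pochhammer (lam + 1/2) l"
      unfolding Suc pochhammer_rec' by simp
    have nz: "of_nat (Suc i) \<noteq> (0 :: complex)" "of_nat k \<noteq> (0 :: complex)"
      using Suc by (simp_all del: of_nat_Suc)
    have "lam + of_nat k - 1/2 \<noteq> 0" using w unfolding w_def ph by auto
    with nz pochhammer_not_Ints [OF c, of l] show ?thesis
      unfolding Suc nat.case jl(1) gegenbauer_coeff_def w_def p_def [symmetric]
      unfolding Suc [symmetric] f ph jl(1) by (simp add: jl(2) divide_simps Suc del: of_nat_Suc)
  qed simp
  have "of_nat (Suc j) * ((2 * lam + of_nat j) * p) =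
    (2 * lam + of_nat (j + 2 * k)) * (of_nat i * p) + 4 * of_nat k * (lam + of_nat k - 1/2) * p"
    by (simp add: j) algebra
  then show ?thesis unfolding e1 e2 e3 by (simp add: add_divide_distrib [symmetric])
qed

text \<open>
  The generating series \<open>f = R powr (- lam)\<close> with \<open>R = 1 - 2 x t + t\<^sup>2\<close> at a fixed \<open>x\<close>. The two series
  \<open>P = (x - t) / R\<close> and \<open>Q = (x\<^sup>2 - 1) / R\<^sup>2\<close> generate a ring stable under differentiation, with
  \<open>P' = P\<^sup>2 + Q\<close> and \<open>Q' = 4 P Q\<close>, and \<open>f' / f = 2 lam P\<close>; so every derivative of \<open>f\<close> is \<open>f\<close> times a
  polynomial in \<open>P\<close> and \<open>Q\<close>. \<open>H j\<close> is that polynomial for the \<open>j\<close>-th derivative divided by \<open>j!\<close>.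
\<close>

locale gegenbauer_at =
  fixes lam x :: complex
  assumes nonint: "lam + 1/2 \<notin> \<int>"
begin

definition R :: "complex fps" where "R = 1 - fps_const (2 * x) * fps_X + fps_X ^ 2"
definition f :: "complex fps" where "f = fps_powr R (- lam)"
definition P :: "complex fps" where "P = (fps_const x - fps_X) * fps_powr R (- 1)"
definition Q :: "complex fps" where "Q = fps_const (x ^ 2 - 1) * fps_powr R (- 1) ^ 2"
definition H :: "nat \<Rightarrow> complex fps" where
  "H j = (\<Sum>k\<le>j. fps_const (gegenbauer_coeff lam j k) * P ^ (j - 2 * k) * Q ^ k)"

lemma R_nth_0: "fps_nth R 0 = 1"
  by (simp add: R_def)

lemma R_inverse: "R * fps_powr R (- 1) = 1"
  by (rule fps_powr_minus_1 [OF R_nth_0])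

lemma R_deriv: "fps_deriv R = - 2 * (fps_const x - fps_X)"
  by (simp add: R_def power2_eq_square algebra_simps flip: fps_const_mult numeral_fps_const)

lemma f_deriv: "fps_deriv f = fps_const (2 * lam) * P * f"
proof -
  have "R * fps_deriv f = fps_const (- lam) * fps_deriv R * f"
    unfolding f_def by (rule fps_powr_deriv [OF R_nth_0])
  moreover have "fps_const (2 * lam) = 2 * fps_const lam" "fps_const (- lam) = - fps_const lam"
    by (simp_all flip: fps_const_mult numeral_fps_const)
  ultimately show ?thesis using R_inverse unfolding P_def R_deriv by algebra
qed

lemma R_inverse_deriv: "fps_deriv (fps_powr R (- 1)) = 2 * (fps_const x - fps_X) * fps_powr R (- 1) ^ 2"
proof -
  have "fps_deriv (R * fps_powr R (- 1)) = 0" by (simp add: R_inverse)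
  then have "fps_deriv R * fps_powr R (- 1) + R * fps_deriv (fps_powr R (- 1)) = 0"
    by (simp add: add.commute)
  then show ?thesis using R_inverse unfolding R_deriv by algebra
qed

lemma P_deriv: "fps_deriv P = P ^ 2 + Q"
proof -
  define J where "J = fps_powr R (- 1)"
  have "fps_deriv P = - J + (fps_const x - fps_X) * fps_deriv J"
    by (simp add: P_def J_def algebra_simps)
  moreover have "fps_const (x ^ 2 - 1) = fps_const x ^ 2 - 1"
    by (simp flip: fps_const_power fps_const_sub fps_const_1_eq_1)
  moreover have "R = 1 - 2 * fps_const x * fps_X + fps_X ^ 2"
    by (simp add: R_def flip: fps_const_mult numeral_fps_const)
  moreover have "R * J = 1" "fps_deriv J = 2 * (fps_const x - fps_X) * J ^ 2"
    by (simp_all add: J_def R_inverse R_inverse_deriv)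
  ultimately show ?thesis
    unfolding P_def Q_def J_def [symmetric] by algebra
qed

lemma Q_deriv: "fps_deriv Q = 4 * P * Q"
proof -
  have "fps_deriv Q = fps_const (x ^ 2 - 1) * (2 * fps_powr R (- 1) * fps_deriv (fps_powr R (- 1)))"
    by (simp add: Q_def power2_eq_square algebra_simps)
  then show ?thesis
    unfolding R_inverse_deriv P_def Q_def by algebra
qed

lemma monomial_deriv:
  "fps_deriv (P ^ i * Q ^ k) = of_nat (i + 4 * k) * P ^ Suc i * Q ^ k + of_nat i * P ^ (i - 1) * Q ^ Suc k"
proof -
  have "fps_deriv (P ^ i) = of_nat i * P ^ Suc i + of_nat i * P ^ (i - 1) * Q"
  proof (cases i)
    case (Suc i')
    have "fps_deriv (P ^ i) = of_nat i * fps_deriv P * P ^ i'"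
      by (simp only: Suc fps_deriv_power' diff_Suc_1)
    then show ?thesis using Suc by (simp add: P_deriv power2_eq_square algebra_simps)
  qed simp
  moreover have "fps_deriv (Q ^ k) = of_nat (4 * k) * P * Q ^ k"
  proof (cases k)
    case (Suc k')
    have "fps_deriv (Q ^ k) = of_nat k * fps_deriv Q * Q ^ k'"
      by (simp only: Suc fps_deriv_power' diff_Suc_1)
    then show ?thesis using Suc by (simp add: Q_deriv algebra_simps)
  qed simp
  ultimately show ?thesis by (simp add: algebra_simps)
qed

lemma H_Suc: "of_nat (Suc j) * H (Suc j) = fps_const (2 * lam) * P * H j + fps_deriv (H j)"
proof -
  let ?e = "gegenbauer_coeff lam" and ?c = "fps_const :: complex \<Rightarrow> _"
  let ?second = "\<lambda>k. case k of 0 \<Rightarrow> 0 | Suc l \<Rightarrow> of_nat (j - 2 * l) * ?e j l"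
  have "fps_const (2 * lam) * P * H j + fps_deriv (H j)
      = (\<Sum>k\<le>j. ?c (?e j k) * (?c (2 * lam) * P * (P ^ (j - 2 * k) * Q ^ k) + fps_deriv (P ^ (j - 2 * k) * Q ^ k)))"
    unfolding H_def sum_distrib_left fps_deriv_sum sum.distrib [symmetric] by (simp add: algebra_simps)
  also have "\<dots> = (\<Sum>k\<le>j. ?c ((2 * lam + of_nat (j + 2 * k)) * ?e j k) * P ^ (Suc j - 2 * k) * Q ^ k
      + ?c (of_nat (j - 2 * k) * ?e j k) * P ^ (Suc j - 2 * Suc k) * Q ^ Suc k)"
  proof (intro sum.cong refl)
    fix k
    show "?c (?e j k) * (?c (2 * lam) * P * (P ^ (j - 2 * k) * Q ^ k) + fps_deriv (P ^ (j - 2 * k) * Q ^ k))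
      = ?c ((2 * lam + of_nat (j + 2 * k)) * ?e j k) * P ^ (Suc j - 2 * k) * Q ^ k
      + ?c (of_nat (j - 2 * k) * ?e j k) * P ^ (Suc j - 2 * Suc k) * Q ^ Suc k"
    proof (cases "2 * k \<le> j")
      case True
      then obtain i where i: "j = 2 * k + i" using le_Suc_ex by blast
      have c: "?c ((2 * lam + of_nat (j + 2 * k)) * ?e j k) = (?c (2 * lam) + of_nat (i + 4 * k)) * ?c (?e j k)"
        "?c (of_nat (j - 2 * k) * ?e j k) = of_nat i * ?c (?e j k)"
        by (simp_all add: i fps_of_nat [symmetric] algebra_simps)
      have "Suc j - 2 * k = Suc i" "Suc j - 2 * Suc k = i - 1" "j - 2 * k = i" using i by auto
      then show ?thesis unfolding c monomial_deriv by (simp add: algebra_simps)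
    qed (simp add: gegenbauer_coeff_def)
  qed
  also have "\<dots> = (\<Sum>k\<le>j. ?c ((2 * lam + of_nat (j + 2 * k)) * ?e j k) * P ^ (Suc j - 2 * k) * Q ^ k)
      + (\<Sum>k\<le>j. ?c (?second (Suc k)) * P ^ (Suc j - 2 * Suc k) * Q ^ Suc k)"
    by (simp add: sum.distrib)
  also have "(\<Sum>k\<le>j. ?c (?second (Suc k)) * P ^ (Suc j - 2 * Suc k) * Q ^ Suc k)
      = (\<Sum>k\<le>Suc j. ?c (?second k) * P ^ (Suc j - 2 * k) * Q ^ k)"
    by (subst sum.atMost_Suc_shift) simp
  also have "(\<Sum>k\<le>j. ?c ((2 * lam + of_nat (j + 2 * k)) * ?e j k) * P ^ (Suc j - 2 * k) * Q ^ k)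
      = (\<Sum>k\<le>Suc j. ?c ((2 * lam + of_nat (j + 2 * k)) * ?e j k) * P ^ (Suc j - 2 * k) * Q ^ k)"
    by (simp add: gegenbauer_coeff_def)
  also have "\<dots> + (\<Sum>k\<le>Suc j. ?c (?second k) * P ^ (Suc j - 2 * k) * Q ^ k)
      = (\<Sum>k\<le>Suc j. ?c (of_nat (Suc j) * ?e (Suc j) k) * P ^ (Suc j - 2 * k) * Q ^ k)"
    unfolding gegenbauer_coeff_Suc [OF nonint] sum.distrib [symmetric]
    by (intro sum.cong refl) (simp only: ring_distribs fps_const_add [symmetric])
  also have "\<dots> = of_nat (Suc j) * H (Suc j)"
    by (simp only: H_def sum_distrib_left fps_const_mult [symmetric] fps_of_nat ac_simps)
  finally show ?thesis ..
qed

text \<open>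
  Both sides are the \<open>j\<close>-th derivative of \<open>f\<close> divided by \<open>j!\<close>.
\<close>

lemma gegenbauer_taylor: "of_nat (n + j choose j) * fps_nth f (n + j) = fps_nth (f * H j) n"
proof (induction j arbitrary: n)
  case 0
  show ?case by (simp add: H_def gegenbauer_coeff_def)
next
  case (Suc j)
  have "of_nat (Suc j) * (f * H (Suc j)) = fps_deriv (f * H j)"
    using H_Suc [of j] f_deriv by (simp only: fps_deriv_mult) algebra
  then have "fps_nth (of_nat (Suc j) * (f * H (Suc j))) n = fps_nth (fps_deriv (f * H j)) n" by simp
  then have "of_nat (Suc j) * fps_nth (f * H (Suc j)) n = of_nat (Suc n) * fps_nth (f * H j) (Suc n)"
    by (simp only: fps_of_nat [symmetric] fps_mult_left_const_nth fps_deriv_nth Suc_eq_plus1)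
  also have "\<dots> = of_nat (Suc n) * (of_nat (Suc n + j choose j) * fps_nth f (Suc n + j))"
    by (simp only: Suc.IH)
  also have "of_nat (Suc n) * (of_nat (Suc n + j choose j) * fps_nth f (Suc n + j))
      = of_nat (Suc j) * (of_nat (n + Suc j choose Suc j) * fps_nth f (n + Suc j))"
  proof -
    have "Suc n * (Suc n + j choose j) = Suc j * (n + Suc j choose Suc j)"
      using binomial_absorb_comp [of "Suc n + j" j] binomial_absorption [of j "n + Suc j"]
      by (simp del: binomial_Suc_Suc mult_Suc mult_Suc_right)
    then have "of_nat (Suc n) * of_nat (Suc n + j choose j) = (of_nat (Suc j) * of_nat (n + Suc j choose Suc j) :: complex)"
      by (metis of_nat_mult)
    then show ?thesis by (simp only: mult.assoc [symmetric]) simp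
  qed
  finally show ?case
    by (metis mult_left_cancel of_nat_neq_0)
qed

end

section \<open>The closed form of the generating function\<close>

lemma fps_mult_compose_nth:
  fixes E F z :: "'a :: idom fps"
  assumes z: "fps_nth z 0 = 0" and m: "m \<le> N"
  shows "fps_nth (E * (F oo z)) m = (\<Sum>k\<le>N. fps_nth F k * fps_nth (E * z ^ k) m)"
proof -
  have compose: "fps_nth (F oo z) l = (\<Sum>k\<le>N. fps_nth F k * fps_nth (z ^ k) l)" if "l \<le> N" for l
    unfolding fps_compose_nth
    by (rule sum.mono_neutral_left) (use that startsby_zero_power_prefix [OF z] in auto)
  have "fps_nth (E * (F oo z)) m = (\<Sum>i=0..m. fps_nth E i * (\<Sum>k\<le>N. fps_nth F k * fps_nth (z ^ k) (m - i)))"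
    using m by (simp add: fps_mult_nth compose)
  also have "\<dots> = (\<Sum>i=0..m. \<Sum>k\<le>N. fps_nth F k * (fps_nth E i * fps_nth (z ^ k) (m - i)))"
    unfolding sum_distrib_left by (intro sum.cong refl mult.left_commute)
  also have "\<dots> = (\<Sum>k\<le>N. fps_nth F k * fps_nth (E * z ^ k) m)"
    by (subst sum.swap) (simp add: fps_mult_nth sum_distrib_left)
  finally show ?thesis .
qed

lemma sum_shift_if:
  fixes g :: "nat \<Rightarrow> 'a :: comm_monoid_add"
  assumes "\<And>i. i + d > N \<Longrightarrow> g i = 0"
  shows "(\<Sum>j\<le>N. if d \<le> j then g (j - d) else 0) = (\<Sum>i\<le>N. g i)"
proof -
  have "(\<Sum>i\<le>N. g i) = (\<Sum>i | i + d \<le> N. g i)"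
    by (rule sum.mono_neutral_right) (use assms in \<open>auto simp: not_le\<close>)
  also have "\<dots> = (\<Sum>j=d..N. g (j - d))"
    by (rule sum.reindex_bij_witness [of _ "\<lambda>j. j - d" "\<lambda>i. i + d"]) auto
  also have "\<dots> = (\<Sum>j=d..N. if d \<le> j then g (j - d) else 0)" by simp
  also have "\<dots> = (\<Sum>j\<le>N. if d \<le> j then g (j - d) else 0)"
    by (rule sum.mono_neutral_left) auto
  finally show ?thesis ..
qed

definition resummation_coeff :: "complex \<Rightarrow> complex \<Rightarrow> nat \<Rightarrow> nat \<Rightarrow> complex" where
  "resummation_coeff b c k i = pochhammer b (2 * k + i) / (4 ^ k * fact k * pochhammer c k * fact i)"

text \<open>
  Expanding the Gauss series and then the powers of \<open>1 - A\<close> gives a double series in \<open>A\<close> and \<open>B\<close>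
  with coefficients \<open>resummation_coeff\<close>, because
  \<open>(b)\<^bsub>2k\<^esub> = 4\<^sup>k (b/2)\<^bsub>k\<^esub> ((b+1)/2)\<^bsub>k\<^esub>\<close> and \<open>(b)\<^bsub>2k\<^esub> (b + 2k)\<^bsub>i\<^esub> = (b)\<^bsub>2k+i\<^esub>\<close>. The right-hand side
  collects it by \<open>j = i + 2 k\<close>; as \<open>A\<close> and \<open>B\<close> are divisible by \<open>X\<close> and \<open>X\<^sup>2\<close>, a truncation at
  \<open>N \<ge> m\<close> keeps all terms that matter.
\<close>

lemma gauss_quadratic_resummation:
  fixes A' B' :: "complex fps" and b c :: complex
  defines "A \<equiv> fps_X * A'" and "B \<equiv> fps_X ^ 2 * B'"
  assumes m: "m \<le> N"
  shows "fps_nth (fps_powr (1 - A) (- b) *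
      (gauss_fps (b / 2) ((b + 1) / 2) c oo (B * fps_powr (1 - A) (- 1) ^ 2))) m =
    (\<Sum>j\<le>N. \<Sum>k\<le>j. if 2 * k \<le> j then
       resummation_coeff b c k (j - 2 * k) * fps_nth (A ^ (j - 2 * k) * B ^ k) m else 0)"
    (is "fps_nth (?E * (?F oo ?z)) m = _")
proof -
  have A0: "fps_nth A 0 = 0" "fps_nth (1 - A) 0 = 1" by (simp_all add: A_def)
  have z0: "fps_nth ?z 0 = 0" by (simp add: B_def fps_mult_nth_0)
  let ?w = "resummation_coeff b c"
  have vanish: "fps_nth (A ^ i * B ^ k) m = 0" if "i + 2 * k > N" for i k
  proof -
    have "A ^ i * B ^ k = fps_X ^ (i + 2 * k) * (A' ^ i * B' ^ k)"
      by (simp only: A_def B_def power_mult_distrib power_add power_mult) (simp only: ac_simps)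
    then show ?thesis using that m by (simp add: fps_X_power_mult_nth)
  qed
  have inner: "fps_nth ?F k * fps_nth (?E * ?z ^ k) m = (\<Sum>i\<le>N. ?w k i * fps_nth (A ^ i * B ^ k) m)" for k
  proof -
    have weight: "fps_nth ?F k * (pochhammer (b + of_nat (2 * k)) i / fact i) = ?w k i" for i
    proof -
      have "pochhammer (b / 2) k * pochhammer ((b + 1) / 2) k * 4 ^ k = pochhammer b (2 * k)"
      proof -
        have "(4 :: complex) ^ k = 2 ^ (2 * k)" by (simp add: power_mult)
        with pochhammer_double [of "b / 2" k] show ?thesis by (simp add: add_divide_distrib ac_simps)
      qed
      then have "pochhammer (b / 2) k * pochhammer ((b + 1) / 2) k = pochhammer b (2 * k) / 4 ^ k"
        by (simp add: field_simps)
      then show ?thesis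
        by (simp only: gauss_fps_nth resummation_coeff_def pochhammer_product') simp
    qed
    have "?E * ?z ^ k = B ^ k * (fps_powr (1 - A) (- b) * fps_powr (1 - A) (of_nat (2 * k) * (- 1)))"
      by (simp add: power_mult_distrib power_mult [symmetric] fps_powr_power [OF A0(2)] mult.commute)
    also have "\<dots> = B ^ k * fps_powr (1 - A) (- b + of_nat (2 * k) * (- 1))"
      by (simp only: fps_powr_add [OF A0(2)])
    also have "\<dots> = B ^ k * (fps_binomial (- (b + of_nat (2 * k))) oo (- A))"
      by (simp add: fps_powr_def)
    finally have "fps_nth (?E * ?z ^ k) m
        = (\<Sum>i\<le>N. fps_nth (fps_binomial (- (b + of_nat (2 * k)))) i * fps_nth (B ^ k * (- A) ^ i) m)"
      by (simp only:) (rule fps_mult_compose_nth, use A0 m in simp_all)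
    also have "\<dots> = (\<Sum>i\<le>N. pochhammer (b + of_nat (2 * k)) i / fact i * fps_nth (A ^ i * B ^ k) m)"
    proof (intro sum.cong refl)
      fix i
      have "(- A) ^ i = fps_const ((- 1) ^ i) * A ^ i"
        by (simp add: power_minus [of A] flip: fps_const_power fps_const_neg)
      then have "B ^ k * (- A) ^ i = fps_const ((- 1) ^ i) * (A ^ i * B ^ k)"
        by (simp only: ac_simps)
      then have "fps_nth (B ^ k * (- A) ^ i) m = (- 1) ^ i * fps_nth (A ^ i * B ^ k) m"
        by (simp only: fps_mult_left_const_nth)
      moreover have "fps_nth (fps_binomial (- (b + of_nat (2 * k)))) i
          = (- 1) ^ i * (pochhammer (b + of_nat (2 * k)) i / fact i)"
        by (simp only: fps_binomial_nth gbinomial_pochhammer minus_minus times_divide_eq_right)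
      moreover have sign: "(- 1) ^ i * q * ((- 1) ^ i * t) = q * t" for q t :: complex
        by (cases "even i") simp_all
      ultimately show "fps_nth (fps_binomial (- (b + of_nat (2 * k)))) i * fps_nth (B ^ k * (- A) ^ i) m =
          pochhammer (b + of_nat (2 * k)) i / fact i * fps_nth (A ^ i * B ^ k) m"
        using sign by (simp only:)
    qed
    finally have "fps_nth ?F k * fps_nth (?E * ?z ^ k) m
        = (\<Sum>i\<le>N. fps_nth ?F k * (pochhammer (b + of_nat (2 * k)) i / fact i) * fps_nth (A ^ i * B ^ k) m)"
      by (simp add: sum_distrib_left mult.assoc)
    then show ?thesis by (simp only: weight)
  qed
  have "fps_nth (?E * (?F oo ?z)) m = (\<Sum>k\<le>N. \<Sum>i\<le>N. ?w k i * fps_nth (A ^ i * B ^ k) m)"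
    by (simp only: fps_mult_compose_nth [OF z0 m] inner)
  also have "\<dots> = (\<Sum>k\<le>N. \<Sum>j\<le>N. if 2 * k \<le> j then ?w k (j - 2 * k) * fps_nth (A ^ (j - 2 * k) * B ^ k) m else 0)"
    by (intro sum.cong refl sum_shift_if [symmetric]) (simp add: vanish)
  also have "\<dots> = (\<Sum>j\<le>N. \<Sum>k\<le>N. if 2 * k \<le> j then ?w k (j - 2 * k) * fps_nth (A ^ (j - 2 * k) * B ^ k) m else 0)"
    by (rule sum.swap)
  also have "\<dots> = (\<Sum>j\<le>N. \<Sum>k\<le>j. if 2 * k \<le> j then ?w k (j - 2 * k) * fps_nth (A ^ (j - 2 * k) * B ^ k) m else 0)"
    by (intro sum.cong refl sum.mono_neutral_right) auto
  finally show ?thesis .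
qed

lemma poly_gauss_2F1_poly:
  "poly (gauss_2F1_poly n b c) u = (\<Sum>j\<le>n. of_nat (n choose j) * (- u) ^ j * pochhammer b j / pochhammer c j)"
proof -
  let ?p = "gauss_2F1_poly n b c"
  have coeff: "coeff ?p j = (if j \<le> n then of_nat (n choose j) * (- 1) ^ j * pochhammer b j / pochhammer c j else 0)" for j
  proof -
    have "pochhammer (- of_nat n) j = fact j * ((- 1) ^ j * (of_nat (n choose j) :: complex))"
      by (cases "even j") (simp_all add: binomial_gbinomial gbinomial_pochhammer)
    then show ?thesis
      by (simp add: gauss_2F1_poly_def coeff_truncate_fps gauss_fps_nth less_Suc_eq_le)
  qed
  have "degree ?p \<le> n" by (rule degree_le) (simp add: coeff)
  then have "poly ?p u = (\<Sum>j\<le>n. coeff ?p j * u ^ j)"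
    unfolding poly_altdef by (intro sum.mono_neutral_left) (auto simp: coeff_eq_0)
  also have "\<dots> = (\<Sum>j\<le>n. of_nat (n choose j) * (- u) ^ j * pochhammer b j / pochhammer c j)"
    by (intro sum.cong refl) (simp add: coeff power_minus [of u])
  finally show ?thesis .
qed

context gegenbauer_at
begin

text \<open>
  The terminating \<open>2F1\<close> is a sum of \<open>(n choose j) (- u) ^ j\<close> with the weights
  \<open>(b)\<^bsub>j\<^esub> / (2 lam)\<^bsub>j\<^esub>\<close>, and \<open>(n choose j)\<close> turns the generating series into its \<open>j\<close>-th Taylor
  coefficient \<open>f * H j\<close>. The weights cancel the factor \<open>(2 lam)\<^bsub>j\<^esub>\<close> of \<open>H j\<close>, which leaves exactly
  the double series of \<open>gauss_quadratic_resummation\<close>.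
\<close>

theorem gegenbauer_2F1_closed_form:
  fixes b u :: complex
  assumes "2 * lam \<notin> \<int>"
  defines "A \<equiv> fps_X * (- fps_const u * P)" and "B \<equiv> fps_X ^ 2 * (fps_const (u ^ 2) * Q)"
  shows "poly (gauss_2F1_poly n b (2 * lam)) u * poly (gegenbauer lam n) x =
    fps_nth (f * (fps_powr (1 - A) (- b) *
      (gauss_fps (b / 2) ((b + 1) / 2) (lam + 1/2) oo (B * fps_powr (1 - A) (- 1) ^ 2)))) n"
proof -
  let ?l = "\<lambda>j. (- u) ^ j * pochhammer b j / pochhammer (2 * lam) j"
  let ?w = "resummation_coeff b (lam + 1/2)"
  have f: "poly (gegenbauer lam n) x = fps_nth f n"
    unfolding poly_gegenbauer f_def fps_powr_def R_def by (simp add: algebra_simps)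
  have H: "fps_const (?l j) * fps_X ^ j * H j =
    (\<Sum>k\<le>j. if 2 * k \<le> j then fps_const (?w k (j - 2 * k)) * (A ^ (j - 2 * k) * B ^ k) else 0)" for j
    unfolding H_def sum_distrib_left
  proof (intro sum.cong refl)
    fix k
    show "fps_const (?l j) * fps_X ^ j * (fps_const (gegenbauer_coeff lam j k) * P ^ (j - 2 * k) * Q ^ k)
      = (if 2 * k \<le> j then fps_const (?w k (j - 2 * k)) * (A ^ (j - 2 * k) * B ^ k) else 0)"
    proof (cases "2 * k \<le> j")
      case True
      then obtain i where i: "j = 2 * k + i" using le_Suc_ex by blast
      have "?l j * gegenbauer_coeff lam j k = ?w k i * ((- u) ^ i * (u ^ 2) ^ k)"
        using pochhammer_not_Ints [OF assms(1), of j]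
        by (simp add: gegenbauer_coeff_def resummation_coeff_def i power_add power_mult)
      then have "fps_const (?l j) * fps_const (gegenbauer_coeff lam j k)
          = fps_const (?w k i) * ((- fps_const u) ^ i * fps_const (u ^ 2) ^ k)"
        unfolding fps_const_mult fps_const_power fps_const_neg by (simp only:)
      moreover have "A ^ i * B ^ k = ((- fps_const u) ^ i * fps_const (u ^ 2) ^ k) * fps_X ^ j * (P ^ i * Q ^ k)"
        by (simp only: A_def B_def i power_mult_distrib power_add power_mult) (simp only: ac_simps)
      moreover have "j - 2 * k = i" using i by simp
      ultimately show ?thesis using True by (simp add: ac_simps del: fps_const_mult) 
    qed (simp add: gegenbauer_coeff_def)
  qed
  let ?G = "fps_powr (1 - A) (- b) *
      (gauss_fps (b / 2) ((b + 1) / 2) (lam + 1/2) oo (B * fps_powr (1 - A) (- 1) ^ 2))"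
  have G: "fps_nth ?G m = fps_nth (\<Sum>j\<le>n. fps_const (?l j) * fps_X ^ j * H j) m" if "m \<le> n" for m
    unfolding A_def B_def gauss_quadratic_resummation [OF that] unfolding A_def [symmetric] B_def [symmetric] H
    by (simp add: fps_sum_nth if_distrib [of "\<lambda>F. fps_nth F m"] cong: if_cong)
  have "poly (gauss_2F1_poly n b (2 * lam)) u * fps_nth f n
      = (\<Sum>j\<le>n. ?l j * (of_nat (n choose j) * fps_nth f n))"
    unfolding poly_gauss_2F1_poly sum_distrib_right by (intro sum.cong refl) (simp add: ac_simps)
  also have "\<dots> = (\<Sum>j\<le>n. ?l j * fps_nth (f * H j) (n - j))"
  proof (intro sum.cong refl)
    show "?l j * (of_nat (n choose j) * fps_nth f n) = ?l j * fps_nth (f * H j) (n - j)" if "j \<in> {..n}" for j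
      using gegenbauer_taylor [of "n - j" j] that by simp
  qed
  also have "\<dots> = (\<Sum>j\<le>n. fps_nth (f * (fps_const (?l j) * fps_X ^ j * H j)) n)"
  proof (intro sum.cong refl)
    fix j assume "j \<in> {..n}"
    have "f * (fps_const (?l j) * fps_X ^ j * H j) = fps_const (?l j) * (fps_X ^ j * (f * H j))"
      by (simp only: ac_simps)
    then show "?l j * fps_nth (f * H j) (n - j) = fps_nth (f * (fps_const (?l j) * fps_X ^ j * H j)) n"
      using \<open>j \<in> {..n}\<close> by (simp only: fps_mult_left_const_nth fps_X_power_mult_nth) simp
  qed
  also have "\<dots> = fps_nth (f * (\<Sum>j\<le>n. fps_const (?l j) * fps_X ^ j * H j)) n"
    by (simp only: sum_distrib_left fps_sum_nth)
  also have "\<dots> = fps_nth (f * ?G) n"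
    unfolding fps_mult_nth [of f] by (intro sum.cong refl) (simp only: G [OF diff_le_self])
  finally show ?thesis by (simp only: f)
qed

end

definition const_ux :: "complex \<Rightarrow> complex poly poly" where
  "const_ux c = [:[:c:]:]"

text \<open>
  Evaluation of an element of \<open>\<complex>[u][x]\<close> at a pair of complex numbers. An identity of series over
  \<open>\<complex>[u][x]\<close> may be checked after all such evaluations, where complex power series are available.
\<close>

definition eval_ux :: "complex \<Rightarrow> complex \<Rightarrow> complex poly poly \<Rightarrow> complex" where
  "eval_ux u x p = poly (poly p [:x:]) u"

interpretation const_ux: coeff_hom const_ux
  by standard (simp_all add: const_ux_def one_pCons)

interpretation eval_ux: coeff_hom "eval_ux u x"
  by standard (simp_all add: eval_ux_def)

lemma eval_ux_const_ux: "map_fps (eval_ux u x) (map_fps const_ux F) = F"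
  by (rule fps_ext) (simp add: eval_ux_def const_ux_def)

lemma eval_ux_eqI:
  assumes "\<And>u x. eval_ux u x p = eval_ux u x q"
  shows "p = q"
proof -
  have "poly (poly (p - q) [:x:]) u = 0" for u x
    using assms by (simp add: eval_ux_def)
  then have "poly (p - q) [:x:] = 0" for x
    by (intro iffD1 [OF poly_all_0_iff_0] allI)
  then have "range (\<lambda>x :: complex. [:x:]) \<subseteq> {y. poly (p - q) y = 0}" by blast
  moreover have "infinite (range (\<lambda>x :: complex. [:x:]))"
    by (simp add: finite_image_iff inj_on_def infinite_UNIV_char_0)
  ultimately have "infinite {y. poly (p - q) y = 0}" by (metis finite_subset)
  then show "p = q" using poly_roots_finite [of "p - q"] by auto
qed

lemma algebraic_fps_lift: "algebraic_fps F \<Longrightarrow> algebraic_fps (map_fps const_ux F)"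
  by (rule algebraic_fps_map [OF const_ux.coeff_hom_axioms]) (simp_all add: inj_def const_ux_def)

text \<open>
  The analogue of \<^const>\<open>fps_powr\<close> over \<open>\<complex>[u][x]\<close>, where the binomial series does not exist as such
  but has its complex coefficients embedded.
\<close>

definition powr_ux :: "complex poly poly fps \<Rightarrow> complex \<Rightarrow> complex poly poly fps" where
  "powr_ux F e = map_fps const_ux (fps_binomial e) oo (F - 1)"

lemma eval_powr_ux: "map_fps (eval_ux u x) (powr_ux F e) = fps_powr (map_fps (eval_ux u x) F) e"
  by (simp add: powr_ux_def fps_powr_def eval_ux.map_fps_compose eval_ux_const_ux
      eval_ux.map_fps_diff eval_ux.map_fps_1)

lemma algebraic_powr_ux:
  assumes "e \<in> \<rat>" "algebraic_fps F" "fps_nth F 0 = 1"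
  shows "algebraic_fps (powr_ux F e)"
  unfolding powr_ux_def using assms
  by (intro algebraic_fps_compose algebraic_fps_lift algebraic_fps_binomial) (auto intro!: algebraic_fps_intros)

text \<open>
  The closed form is an expression over \<open>\<complex>[u][x]\<close> built from algebraic series by operations that
  preserve algebraicity; it agrees with the generating function at all complex \<open>u\<close> and \<open>x\<close>.
\<close>

theorem algebraic_gegenbauer_2F1_gf:
  fixes lam \<gamma> :: complex
  defines "b \<equiv> 2 * lam - \<gamma>"
  assumes rat: "lam \<in> \<rat>" "\<gamma> \<in> \<rat>" and nonint: "2 * lam \<notin> \<int>"
    and alg: "algebraic_gauss (b / 2) ((b + 1) / 2) (lam + 1/2)"
  shows "algebraic_fps (gegenbauer_2F1_gf lam \<gamma>)"
proof -
  define X :: "complex poly poly fps" where "X = fps_X"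
  define x :: "complex poly poly" where "x = [:0, 1:]"
  define u :: "complex poly poly" where "u = [:[:0, 1:]:]"
  define R where "R = 1 - fps_const (2 * x) * X + X ^ 2"
  define f where "f = powr_ux R (- lam)"
  define P where "P = (fps_const x - X) * powr_ux R (- 1)"
  define Q where "Q = fps_const (x ^ 2 - 1) * powr_ux R (- 1) ^ 2"
  define A where "A = X * (- fps_const u * P)"
  define B where "B = X ^ 2 * (fps_const (u ^ 2) * Q)"
  define E where "E = powr_ux (1 - A) (- b)"
  define z where "z = B * powr_ux (1 - A) (- 1) ^ 2"
  define G where "G = map_fps const_ux (gauss_fps (b / 2) ((b + 1) / 2) (lam + 1/2)) oo z"
  have "gegenbauer_2F1_gf lam \<gamma> = f * (E * G)"
  proof (intro fps_ext eval_ux_eqI)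
    fix n u0 x0
    interpret pt: gegenbauer_at lam x0
    proof
      show "lam + 1/2 \<notin> \<int>"
      proof
        assume "lam + 1/2 \<in> \<int>"
        then have "2 * (lam + 1/2) - 1 \<in> \<int>" by (intro Ints_diff Ints_mult) auto
        with nonint show False by simp
      qed
    qed
    let ?ev = "map_fps (eval_ux u0 x0)"
    note hom = eval_ux.map_fps_add eval_ux.map_fps_diff eval_ux.map_fps_uminus eval_ux.map_fps_mult eval_ux.map_fps_power
      eval_ux.map_fps_1 eval_ux.map_fps_X eval_ux.map_fps_const eval_powr_ux eval_ux_const_ux
      eval_ux.map_fps_compose
    have evals: "eval_ux u0 x0 x = x0" "eval_ux u0 x0 (2 * x) = 2 * x0" "eval_ux u0 x0 (x ^ 2 - 1) = x0 ^ 2 - 1"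
      "eval_ux u0 x0 u = u0" "eval_ux u0 x0 (u ^ 2) = u0 ^ 2"
      by (simp_all add: eval_ux_def x_def u_def)
    have R': "?ev R = pt.R"
      unfolding R_def X_def pt.R_def by (simp only: hom evals)
    have P': "?ev P = pt.P"
      unfolding P_def X_def pt.P_def by (simp only: hom evals R')
    have Q': "?ev Q = pt.Q"
      unfolding Q_def pt.Q_def by (simp only: hom evals R')
    have f': "?ev f = pt.f"
      unfolding f_def pt.f_def by (simp only: hom R')
    have "eval_ux u0 x0 (fps_nth (gegenbauer_2F1_gf lam \<gamma>) n)
        = poly (gauss_2F1_poly n b (2 * lam)) u0 * poly (gegenbauer lam n) x0"
    proof -
      have "poly (map_poly (\<lambda>a. [:a:]) p) [:x0:] = [:poly p x0:]" for p :: "complex poly"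
        by (induction p) (simp_all add: map_poly_pCons)
      then show ?thesis by (simp add: gegenbauer_2F1_gf_def eval_ux_def b_def)
    qed
    also have "\<dots> = fps_nth (?ev (f * (E * G))) n"
      unfolding pt.gegenbauer_2F1_closed_form [OF nonint]
      by (simp only: hom evals f' P' Q' E_def G_def z_def A_def B_def X_def)
    finally show "eval_ux u0 x0 (fps_nth (gegenbauer_2F1_gf lam \<gamma>) n) = eval_ux u0 x0 (fps_nth (f * (E * G)) n)"
      by simp
  qed
  moreover have "algebraic_fps (f * (E * G))"
  proof -
    have R0: "fps_nth R 0 = 1" by (simp add: R_def X_def)
    have R: "algebraic_fps R" unfolding R_def X_def by (intro algebraic_fps_intros)
    have P: "algebraic_fps P" unfolding P_def X_def
      by (intro algebraic_fps_intros algebraic_powr_ux R R0) simp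
    have Q: "algebraic_fps Q" unfolding Q_def
      by (intro algebraic_fps_intros algebraic_powr_ux R R0) simp
    have A: "algebraic_fps (1 - A)" unfolding A_def X_def by (intro algebraic_fps_intros P)
    have A0: "fps_nth (1 - A) 0 = 1" by (simp add: A_def X_def)
    have f: "algebraic_fps f" unfolding f_def using rat by (intro algebraic_powr_ux R R0) simp
    have E: "algebraic_fps E"
      unfolding E_def b_def using rat by (intro algebraic_powr_ux A A0) simp
    have z: "algebraic_fps z" unfolding z_def B_def X_def
      by (intro algebraic_fps_intros algebraic_powr_ux A A0 Q) simp
    have "fps_nth z 0 = 0" by (simp add: z_def B_def X_def fps_mult_nth_0 fps_nth_power_0)
    then have "algebraic_fps G" unfolding G_def by (intro algebraic_fps_compose algebraic_fps_lift alg z)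
    with f E show ?thesis by (intro algebraic_fps_mult)
  qed
  ultimately show ?thesis by simp
qed

section \<open>Reduction to representatives of the parameter classes\<close>

text \<open>
  Algebraicity of the Gauss series in the closed form, in terms of \<open>lam\<close> and \<open>\<delta> = \<gamma> - lam\<close>. Its
  exponent differences are \<open>1/2 - lam\<close> at \<open>0\<close>, \<open>\<delta>\<close> at \<open>1\<close> and \<open>1/2\<close> at infinity.
\<close>

definition algebraic_kernel :: "complex \<Rightarrow> complex \<Rightarrow> bool" where
  "algebraic_kernel lam \<delta> \<longleftrightarrow> algebraic_gauss ((lam - \<delta>) / 2) ((lam - \<delta> + 1) / 2) (lam + 1/2)"

lemma half_notin_Ints: "z \<notin> \<int> \<Longrightarrow> z / 2 \<notin> \<int>" for z :: complex
  by (metis Ints_mult Ints_numeral nonzero_mult_div_cancel_left times_divide_eq_right zero_neq_numeral)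

lemma nonresonant_kernel:
  assumes "lam - \<delta> \<notin> \<int>" "lam + \<delta> \<notin> \<int>" "2 * lam \<notin> \<int>"
  shows "nonresonant ((lam - \<delta>) / 2) ((lam - \<delta> + 1) / 2) (lam + 1/2)"
proof -
  have e: "lam + 1/2 = (2 * lam + 1) / 2" "(2 * lam + 1) / 2 - (lam - \<delta>) / 2 = (lam + \<delta> + 1) / 2"
    "(2 * lam + 1) / 2 - (lam - \<delta> + 1) / 2 = (lam + \<delta>) / 2"
    by (simp_all add: field_simps)
  show ?thesis
    unfolding nonresonant_def e by (intro conjI half_notin_Ints add_Ints_notin_Ints assms Ints_1)
qed

lemma algebraic_kernel_shift:
  assumes "lam - \<delta> \<notin> \<int>" "lam + \<delta> \<notin> \<int>" "2 * lam \<notin> \<int>" and alg: "algebraic_kernel lam \<delta>"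
  shows "algebraic_kernel (lam + of_int i) (\<delta> + of_int j)"
proof -
  let ?a = "(lam - \<delta>) / 2" and ?b = "(lam - \<delta> + 1) / 2" and ?c = "lam + 1/2"
  have shift: "algebraic_gauss (?a + of_int k) (?b + of_int l) (?c + of_int i)" for k l
    by (rule algebraic_gauss_contiguous [OF nonresonant_kernel [OF assms(1-3)] alg [unfolded algebraic_kernel_def]])
  have c: "lam + of_int i + 1/2 = ?c + of_int i" by simp
  show ?thesis
  proof (cases "even (i - j)")
    case True
    then obtain m where "i - j = 2 * m" by (rule evenE)
    then have i: "i = j + 2 * m" by simp
    have e: "(lam + of_int i - (\<delta> + of_int j)) / 2 = ?a + of_int m"
      "(lam + of_int i - (\<delta> + of_int j) + 1) / 2 = ?b + of_int m"
      by (simp_all add: i field_simps)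
    show ?thesis unfolding algebraic_kernel_def c e by (rule shift)
  next
    case False
    \<comment> \<open>An odd shift interchanges the roles of the two upper parameters.\<close>
    then obtain m where "i - j = 2 * m + 1" by (rule oddE)
    then have i: "i = j + 2 * m + 1" by simp
    have e: "(lam + of_int i - (\<delta> + of_int j)) / 2 = ?b + of_int m"
      "(lam + of_int i - (\<delta> + of_int j) + 1) / 2 = ?a + of_int (m + 1)"
      by (simp_all add: i field_simps)
    show ?thesis unfolding algebraic_kernel_def c e
      using shift [of "m + 1" m] by (subst gauss_fps_commute)
  qed
qed

text \<open>
  Euler's transformation changes the sign of the exponent difference \<open>\<delta>\<close> at \<open>1\<close>.
\<close>

lemma algebraic_kernel_uminus:
  assumes "lam \<in> \<rat>" "\<delta> \<in> \<rat>" "2 * lam \<notin> \<int>" "algebraic_kernel lam \<delta>"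
  shows "algebraic_kernel lam (- \<delta>)"
proof -
  let ?a = "(lam - (- \<delta>)) / 2" and ?b = "(lam - (- \<delta>) + 1) / 2" and ?c = "lam + 1/2"
  have c: "?c \<notin> \<int>"
    using half_notin_Ints [OF add_Ints_notin_Ints [OF assms(3) Ints_1]] by (simp add: add_divide_distrib)
  have e: "?c - ?a = (lam - \<delta> + 1) / 2" "?c - ?b = (lam - \<delta>) / 2" "?c - ?a - ?b = - \<delta>"
    by (simp_all add: field_simps)
  have "algebraic_gauss (?c - ?a) (?c - ?b) ?c"
    using assms(4) unfolding e algebraic_kernel_def by (subst gauss_fps_commute)
  moreover have "algebraic_fps (fps_powr (1 - fps_X) (?c - ?a - ?b))"
    unfolding e using assms by (intro algebraic_fps_powr algebraic_fps_intros) simp_all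
  ultimately show ?thesis
    unfolding algebraic_kernel_def gauss_fps_euler [OF c, of ?a ?b] by (intro algebraic_fps_mult)
qed

lemma algebraic_kernel_int_pm:
  assumes base: "algebraic_kernel lam0 \<delta>0" "lam0 \<in> \<rat>" "\<delta>0 \<in> \<rat>"
    "lam0 - \<delta>0 \<notin> \<int>" "lam0 + \<delta>0 \<notin> \<int>" "2 * lam0 \<notin> \<int>"
    and "lam - lam0 \<in> \<int>" "\<gamma> - lam \<in> int_pm \<delta>0"
  shows "algebraic_fps (gegenbauer_2F1_gf lam \<gamma>)"
proof -
  from assms obtain i where i: "lam = lam0 + of_int i" by (metis Ints_cases add_diff_cancel_left' diff_add_cancel add.commute)
  from assms(8) obtain k where k: "k \<in> \<int>" "\<gamma> - lam = k + \<delta>0 \<or> \<gamma> - lam = k - \<delta>0"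
    unfolding int_pm_def by blast
  from k(1) obtain j where "k = of_int j" by (rule Ints_cases)
  with k(2) have j: "\<gamma> - lam = \<delta>0 + of_int j \<or> \<gamma> - lam = - \<delta>0 + of_int j"
    by (auto simp: add.commute)
  have "algebraic_kernel lam0 (- \<delta>0)" by (rule algebraic_kernel_uminus) (use base in auto)
  then have shifted: "algebraic_kernel lam (\<gamma> - lam)"
    using j base algebraic_kernel_shift [of lam0 \<delta>0 i j] algebraic_kernel_shift [of lam0 "- \<delta>0" i j]
    unfolding i by auto
  have "lam \<in> \<rat>" unfolding i using base by simp
  moreover have "\<gamma> - lam \<in> \<rat>" using j base by auto
  ultimately have "lam \<in> \<rat>" "\<gamma> \<in> \<rat>" using Rats_add [of "\<gamma> - lam" lam] by simp_all
  moreover have "2 * lam \<notin> \<int>"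
    using add_Ints_notin_Ints [OF base(6), of "2 * of_int i"] unfolding i by (simp add: ring_distribs)
  moreover have "algebraic_gauss ((2 * lam - \<gamma>) / 2) ((2 * lam - \<gamma> + 1) / 2) (lam + 1/2)"
    using shifted by (simp add: algebraic_kernel_def)
  ultimately show ?thesis by (rule algebraic_gegenbauer_2F1_gf)
qed

text \<open>
  Since \<open>- a\<close> and \<open>1 - a\<close> differ by an integer, the class of \<open>- a\<close> has the representative \<open>1 - a\<close>,
  for which the conjugate evaluations were given.
\<close>

lemma int_pm_cases:
  assumes "lam \<in> int_pm a"
  shows "lam - a \<in> \<int> \<or> lam - (1 - a) \<in> \<int>"
  using assms by (auto simp: int_pm_def)

theorem theorem1p9:
  fixes lam \<gamma> :: complex
  assumes "(lam \<in> int_pm (1/4) \<and> \<gamma> - lam \<in> int_pm (1/3)) \<or>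
           (lam \<in> int_pm (1/6) \<and> \<gamma> - lam \<in> int_pm (1/3) \<union> int_pm (1/4))"
  shows "algebraic_fps (gegenbauer_2F1_gf lam \<gamma>)"
proof -
  have base: "algebraic_kernel (1/4) (1/3)" "algebraic_kernel (3/4) (1/3)" "algebraic_kernel (1/6) (1/3)"
    "algebraic_kernel (5/6) (1/3)" "algebraic_kernel (1/6) (1/4)" "algebraic_kernel (5/6) (1/4)"
    using algebraic_gauss_tetrahedral algebraic_gauss_tetrahedral_conj algebraic_gauss_octahedral_4 algebraic_gauss_octahedral_4_conj algebraic_gauss_octahedral_3 algebraic_gauss_octahedral_3_conj by (simp_all add: algebraic_kernel_def)
  from assms consider
      "lam - 1/4 \<in> \<int>" "\<gamma> - lam \<in> int_pm (1/3)" | "lam - 3/4 \<in> \<int>" "\<gamma> - lam \<in> int_pm (1/3)"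
    | "lam - 1/6 \<in> \<int>" "\<gamma> - lam \<in> int_pm (1/3)" | "lam - 5/6 \<in> \<int>" "\<gamma> - lam \<in> int_pm (1/3)"
    | "lam - 1/6 \<in> \<int>" "\<gamma> - lam \<in> int_pm (1/4)" | "lam - 5/6 \<in> \<int>" "\<gamma> - lam \<in> int_pm (1/4)"
    using int_pm_cases [of lam "1/4"] int_pm_cases [of lam "1/6"] by auto
  then show ?thesis
  proof cases
    case 1 show ?thesis by (rule algebraic_kernel_int_pm [OF base(1) _ _ _ _ _ 1]) simp_all
  next
    case 2 show ?thesis by (rule algebraic_kernel_int_pm [OF base(2) _ _ _ _ _ 2]) simp_all
  next
    case 3 show ?thesis by (rule algebraic_kernel_int_pm [OF base(3) _ _ _ _ _ 3]) simp_all
  next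
    case 4 show ?thesis by (rule algebraic_kernel_int_pm [OF base(4) _ _ _ _ _ 4]) simp_all
  next
    case 5 show ?thesis by (rule algebraic_kernel_int_pm [OF base(5) _ _ _ _ _ 5]) simp_all
  next
    case 6 show ?thesis by (rule algebraic_kernel_int_pm [OF base(6) _ _ _ _ _ 6]) simp_all
  qed
qed

end
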